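(* Let $F=F(x_1,\ldots,x_r)\in\mathbb{C}[x_1,\ldots,x_r]$ be a smooth form of degree $d\ge 3$, where $r\ge 1$. If $G$ is a subgroup of $\mathrm{Aut}(F)$, then $|G|\le B(G,F)$, where $B(G,F)$ is the canonical bound of $G$.
   Context: A form (homogeneous polynomial) $F\in\mathbb{C}[x_1,\dots,x_r]$ is smooth if the origin is the only common zero of its first partial derivatives. $\mathrm{Aut}(F)=\{A\in\mathrm{GL}(r,\mathbb{C})\mid A(F)=F\}$ where $A(F)=F(\sum_i a_{1i}x_i,\ldots,\sum_i a_{ri}x_i)$; this is a finite group. A finite group acting irreducibly on a complex vector space $W$ acts primitively if $W$ cannot be decomposed as a direct sum of proper subspaces permuted by the group. Decomposition data of a finite subgroup $G\subset\mathrm{GL}(r,\mathbb{C})$: write $\mathbb{C}^r=V_1\oplus\cdots\oplus V_m$ with $V_i$ irreducible $G$-stable subspaces, and for each $i$ write $V_i=W_{i1}\oplus\cdots\oplus W_{ik_i}$ ($k_i\ge 1$) with subspaces permuted transitively by $G$ and such that $\mathrm{Stab}_G(W_{ij})=\{g\in G\mid g(W_{ij})=W_{ij}\}$ acts primitively (not necessarily faithfully) on $W_{ij}$. Such data always exist, and one choice is fixed for each $G$. Let $s=k_1+\cdots+k_m$ and let $H_{ij}\subset\mathrm{PGL}(W_{ij})$ be the image of $\mathrm{Stab}_G(W_{ij})$ (the primitive constituents of $G$). The canonical bound of $G\subset\mathrm{Aut}(F)$ is $$B(G,F)=d^s\cdot\prod_{i=1}^m\prod_{j=1}^{k_i}|H_{ij}|\cdot\prod_{i=1}^m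 k_i!.$$ *)

theory Defs
  imports "HOL-Analysis.Cartesian_Space" "HOL-Library.Poly_Mapping"
    "HOL-Algebra.Coset" "HOL-Algebra.Bij"
begin

section \<open>Forms in the variables indexed by a finite type\<close>

text \<open>A monomial is its exponent vector; a polynomial maps monomials to coefficients, with the
  convolution product of the library. The number \<open>r\<close> of variables is \<open>CARD('n)\<close>, which is
  automatically positive.\<close>

type_synonym 'n cpoly = "('n \<Rightarrow>\<^sub>0 nat) \<Rightarrow>\<^sub>0 complex"

definition const_poly :: "complex \<Rightarrow> 'n cpoly" where
  "const_poly c = Poly_Mapping.single 0 c"

definition var_poly :: "'n \<Rightarrow> 'n cpoly" where
  "var_poly i = Poly_Mapping.single (Poly_Mapping.single i 1) 1"

definition eval_poly :: "'n::finite cpoly \<Rightarrow> complex ^ 'n \<Rightarrow> complex" where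
  "eval_poly F x = (\<Sum>m \<in> Poly_Mapping.keys F.
     Poly_Mapping.lookup F m * (\<Prod>i\<in>UNIV. (x $ i) ^ Poly_Mapping.lookup m i))"

text \<open>If the variable \<open>i\<close> does not occur in \<open>m\<close>, the truncated exponent below is harmless,
  because the coefficient is then \<open>0\<close>.\<close>

definition partial_deriv :: "'n \<Rightarrow> 'n cpoly \<Rightarrow> 'n cpoly" where
  "partial_deriv i F = (\<Sum>m \<in> Poly_Mapping.keys F.
     Poly_Mapping.single (m - Poly_Mapping.single i 1)
       (of_nat (Poly_Mapping.lookup m i) * Poly_Mapping.lookup F m))"

definition form_of_degree :: "nat \<Rightarrow> 'n::finite cpoly \<Rightarrow> bool" where
  "form_of_degree d F \<longleftrightarrow>
     (\<forall>m \<in> Poly_Mapping.keys F. (\<Sum>i\<in>UNIV. Poly_Mapping.lookup m i) = d)"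

definition smooth_form :: "'n::finite cpoly \<Rightarrow> bool" where
  "smooth_form F \<longleftrightarrow> {x. \<forall>i. eval_poly (partial_deriv i F) x = 0} = {0}"

text \<open>\<open>A(F)\<close>: the \<open>k\<close>-th variable is replaced by \<open>\<Sum>i. a\<^sub>k\<^sub>i x\<^sub>i\<close>, as an identity of polynomials.\<close>

definition lin_subst :: "complex ^ 'n ^ 'n \<Rightarrow> 'n::finite cpoly \<Rightarrow> 'n cpoly" where
  "lin_subst A F = (\<Sum>m \<in> Poly_Mapping.keys F. const_poly (Poly_Mapping.lookup F m) *
     (\<Prod>k\<in>UNIV. (\<Sum>i\<in>UNIV. const_poly (A $ k $ i) * var_poly i) ^ Poly_Mapping.lookup m k))"

definition GL :: "(complex ^ 'n ^ 'n) monoid" where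
  "GL = \<lparr>carrier = {A. invertible A}, monoid.mult = (**), one = mat 1\<rparr>"

lemma group_GL: "group GL"
proof (rule groupI)
  fix A :: "complex ^ 'n ^ 'n" assume "A \<in> carrier GL"
  then obtain B where "A ** B = mat 1" "B ** A = mat 1" unfolding GL_def invertible_def by auto
  then show "\<exists>B\<in>carrier GL. B \<otimes>\<^bsub>GL\<^esub> A = \<one>\<^bsub>GL\<^esub>"
    unfolding GL_def invertible_def by auto
next
  fix A B :: "complex ^ 'n ^ 'n" assume "A \<in> carrier GL" "B \<in> carrier GL"
  then show "A \<otimes>\<^bsub>GL\<^esub> B \<in> carrier GL" by (simp add: GL_def invertible_mult)
next
  have "invertible (mat 1 :: complex ^ 'n ^ 'n)" by (auto simp: invertible_def)
  then show "\<one>\<^bsub>GL\<^esub> \<in> carrier (GL :: (complex ^ 'n ^ 'n) monoid)" by (simp add: GL_def)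
qed (auto simp: GL_def matrix_mul_assoc)

definition Aut_form :: "'n::finite cpoly \<Rightarrow> (complex ^ 'n ^ 'n) set" where
  "Aut_form F = {A \<in> carrier GL. lin_subst A F = F}"

section \<open>Irreducible and primitive actions on subspaces\<close>

text \<open>All subspaces are complex: \<open>vec.subspace\<close> refers to the scalar multiplication \<open>(*s)\<close>, whereas
  \<open>subspace\<close> would mean real subspaces. A matrix \<open>g\<close> sends a subspace \<open>U\<close> to \<open>(*v) g ` U\<close>.\<close>

text \<open>\<open>W\<close> is the internal direct sum of the \<open>U i\<close>: the addition map from their product to \<open>W\<close>
  is a bijection.\<close>

definition is_direct_sum :: "'i set \<Rightarrow> ('i \<Rightarrow> (complex ^ 'n) set) \<Rightarrow> (complex ^ 'n) set \<Rightarrow> bool" where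
  "is_direct_sum I U W \<longleftrightarrow> finite I \<and> (\<forall>i\<in>I. vec.subspace (U i)) \<and>
     bij_betw (\<lambda>u. \<Sum>i\<in>I. u i) (Pi\<^sub>E I U) W"

definition stable_subspace :: "(complex ^ 'n ^ 'n) set \<Rightarrow> (complex ^ 'n) set \<Rightarrow> bool" where
  "stable_subspace H U \<longleftrightarrow> vec.subspace U \<and> (\<forall>h\<in>H. (*v) h ` U \<subseteq> U)"

definition acts_irreducibly :: "(complex ^ 'n ^ 'n) set \<Rightarrow> (complex ^ 'n) set \<Rightarrow> bool" where
  "acts_irreducibly H W \<longleftrightarrow> stable_subspace H W \<and> W \<noteq> {0} \<and>
     (\<forall>U. stable_subspace H U \<and> U \<subseteq> W \<longrightarrow> U = {0} \<or> U = W)"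

definition acts_primitively :: "(complex ^ 'n ^ 'n) set \<Rightarrow> (complex ^ 'n) set \<Rightarrow> bool" where
  "acts_primitively H W \<longleftrightarrow> acts_irreducibly H W \<and>
     \<not> (\<exists>P. is_direct_sum P (\<lambda>U. U) W \<and> (\<forall>U\<in>P. U \<subset> W) \<and> (\<forall>h\<in>H. \<forall>U\<in>P. (*v) h ` U \<in> P))"

definition setwise_stab :: "(complex ^ 'n ^ 'n) set \<Rightarrow> (complex ^ 'n) set \<Rightarrow> (complex ^ 'n ^ 'n) set" where
  "setwise_stab G W = {g \<in> G. (*v) g ` W = W}"

section \<open>Decomposition data and the canonical bound\<close>

text \<open>Indices start at \<open>0\<close>: \<open>V i\<close> and \<open>k i\<close> are meaningful for \<open>i < m\<close>, and \<open>W i j\<close> for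
  \<open>i < m\<close>, \<open>j < k i\<close>.\<close>

definition decomposition_data ::
  "(complex ^ 'n ^ 'n) set \<Rightarrow> nat \<Rightarrow> (nat \<Rightarrow> (complex ^ 'n) set) \<Rightarrow> (nat \<Rightarrow> nat) \<Rightarrow>
   (nat \<Rightarrow> nat \<Rightarrow> (complex ^ 'n) set) \<Rightarrow> bool" where
  "decomposition_data G m V k W \<longleftrightarrow>
     is_direct_sum {..<m} V UNIV \<and>
     (\<forall>i<m. acts_irreducibly G (V i) \<and> k i \<ge> 1 \<and>
        is_direct_sum {..<k i} (W i) (V i) \<and>
        (\<forall>g\<in>G. \<forall>j<k i. \<exists>j'<k i. (*v) g ` W i j = W i j') \<and>
        (\<forall>j<k i. \<forall>j'<k i. \<exists>g\<in>G. (*v) g ` W i j = W i j') \<and>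
        (\<forall>j<k i. acts_primitively (setwise_stab G (W i j)) (W i j)))"

text \<open>\<open>PGL(W)\<close> is the quotient of \<open>GL(W)\<close>, the group of linear bijections of \<open>W\<close>
  (extensional outside \<open>W\<close>), by the nonzero scalars.\<close>

definition GL_on :: "(complex ^ 'n) set \<Rightarrow> (complex ^ 'n \<Rightarrow> complex ^ 'n) monoid" where
  "GL_on W = BijGroup W
     \<lparr>carrier := {f \<in> Bij W. (\<forall>v\<in>W. \<forall>w\<in>W. f (v + w) = f v + f w) \<and>
                             (\<forall>c. \<forall>v\<in>W. f (c *s v) = c *s f v)}\<rparr>"

definition scalars_on :: "(complex ^ 'n) set \<Rightarrow> (complex ^ 'n \<Rightarrow> complex ^ 'n) set" where
  "scalars_on W = {restrict (\<lambda>v. c *s v) W | c. c \<noteq> 0}"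

definition PGL_on :: "(complex ^ 'n) set \<Rightarrow> (complex ^ 'n \<Rightarrow> complex ^ 'n) set monoid" where
  "PGL_on W = GL_on W Mod scalars_on W"

definition to_PGL :: "(complex ^ 'n) set \<Rightarrow> complex ^ 'n ^ 'n \<Rightarrow> (complex ^ 'n \<Rightarrow> complex ^ 'n) set" where
  "to_PGL W g = scalars_on W #>\<^bsub>GL_on W\<^esub> restrict ((*v) g) W"

definition primitive_constituent ::
  "(complex ^ 'n ^ 'n) set \<Rightarrow> (complex ^ 'n) set \<Rightarrow> (complex ^ 'n \<Rightarrow> complex ^ 'n) set set" where
  "primitive_constituent G W = to_PGL W ` setwise_stab G W"

lemma primitive_constituent_subset_PGL:
  assumes "G \<subseteq> carrier GL" "vec.subspace W"
  shows "primitive_constituent G W \<subseteq> carrier (PGL_on W)"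
proof -
  have "restrict ((*v) g) W \<in> carrier (GL_on W)" if "g \<in> setwise_stab G W" for g
  proof -
    have inv: "invertible g" and im: "(*v) g ` W = W"
      using that assms by (auto simp: setwise_stab_def GL_def)
    have "inj_on ((*v) g) W" using inj_matrix_vector_mult[OF inv] inj_on_subset by blast
    with im have "bij_betw ((*v) g) W W" by (simp add: bij_betw_def)
    then show ?thesis using assms(2)
      by (auto simp: GL_on_def Bij_def matrix_vector_right_distrib vec.subspace_add
          vec.subspace_scale vector_scalar_commute)
  qed
  then show ?thesis
    by (auto simp: primitive_constituent_def to_PGL_def PGL_on_def FactGroup_def RCOSETS_def)
qed

text \<open>The degree \<open>d\<close> is the only information about the form that enters \<open>B(G,F)\<close>.\<close>

definition canonical_bound ::
  "nat \<Rightarrow> (complex ^ 'n ^ 'n) set \<Rightarrow> nat \<Rightarrow> (nat \<Rightarrow> nat) \<Rightarrow>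
   (nat \<Rightarrow> nat \<Rightarrow> (complex ^ 'n) set) \<Rightarrow> nat" where
  "canonical_bound d G m k W =
     d ^ (\<Sum>i<m. k i) * (\<Prod>i<m. \<Prod>j<k i. card (primitive_constituent G (W i j))) *
     (\<Prod>i<m. fact (k i))"

end

theory Submission
  imports "Jordan_Normal_Form.Schur_Decomposition" "HOL-Analysis.Determinants" Defs
begin

text \<open>Write \<open>D F(x)(w)\<close> for the derivative of \<open>F\<close> at \<open>x\<close> in direction \<open>w\<close>. Differentiating
  \<open>F(A x) = F(x)\<close> gives \<open>D F(A x)(A w) = D F(x)(w)\<close>, and smoothness makes \<open>D F(x)\<close> a nonzero functional
  for \<open>x \<noteq> 0\<close>.

  Finiteness: if \<open>A v = \<mu> v\<close>, then \<open>D F(v)\<close> is an eigenvector of the transpose of \<open>A\<close> with eigenvalue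
  \<open>\<mu>\<close> to the power \<open>-(d - 1)\<close>. The spectrum of \<open>A\<close> is therefore closed under this power map; as it has
  at most \<open>r\<close> elements and \<open>d - 1 \<ge> 2\<close>, all eigenvalues are roots of unity of bounded order. So the
  elements of \<open>G\<close> have only finitely many traces, and as in Burnside's theorem a completely
  reducible group with finitely many traces is finite.

  The bound: \<open>G\<close> permutes the \<open>W i j\<close> within each block \<open>i\<close>, the kernel maps to the product of the
  primitive constituents, and what remains acts on each \<open>W i j\<close> by a scalar \<open>t i j\<close>. A nonzero
  \<open>p \<in> W i j\<close> has \<open>D F(p) \<noteq> 0\<close> on some \<open>W i' j'\<close>, which forces \<open>t i j ^ (d - 1) * t i' j' = 1\<close>.
  Such a system of \<open>s\<close> equations has at most \<open>d ^ s\<close> solutions.\<close>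

no_notation Matrix.vec_index (infixl \<open>$\<close> 100)
hide_const (open) Matrix.mat

section \<open>Systems of monomial equations\<close>

lemma card_le_card_mult_fibre:
  assumes "finite A" "f ` A \<subseteq> B" "finite B"
    and fib: "\<And>x. x \<in> A \<Longrightarrow> card {y \<in> A. f y = f x} \<le> N"
  shows "card A \<le> card B * N"
proof -
  have "card A = (\<Sum>b\<in>f ` A. card {y \<in> A. f y = b})"
    using sum.image_gen[OF \<open>finite A\<close>, of "\<lambda>_. 1::nat" f] by simp
  also have "\<dots> \<le> (\<Sum>b\<in>f ` A. N)"
    by (rule sum_mono) (use fib in auto)
  also have "\<dots> = card (f ` A) * N" by simp
  also have "\<dots> \<le> card B * N"
    using card_mono[OF assms(3,2)] by (rule mult_le_mono1)
  finally show ?thesis .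
qed

text \<open>A negative exponent becomes a positive one when \<open>c\<close> is inverted, and a
  nonzero complex number has exactly as many roots as the exponent says.\<close>

lemma powi_roots:
  fixes c :: complex
  assumes "n \<noteq> 0" "c \<noteq> 0"
  shows "finite {z. z \<noteq> 0 \<and> z powi n = c}" "card {z. z \<noteq> 0 \<and> z powi n = c} \<le> nat \<bar>n\<bar>"
proof -
  define c' where "c' = (if n > 0 then c else inverse c)"
  have c': "c' \<noteq> 0" using assms by (simp add: c'_def)
  have pos: "nat \<bar>n\<bar> > 0" using assms by simp
  have sub: "{z. z \<noteq> 0 \<and> z powi n = c} \<subseteq> {z. z ^ nat \<bar>n\<bar> = c'}"
    using assms by (auto simp: c'_def power_int_def power_inverse split: if_splits)
  have fin: "finite {z. z ^ nat \<bar>n\<bar> = c'}" using finite_nth_roots[OF pos] .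
  show "finite {z. z \<noteq> 0 \<and> z powi n = c}" using finite_subset[OF sub fin] .
  show "card {z. z \<noteq> 0 \<and> z powi n = c} \<le> nat \<bar>n\<bar>"
    using card_mono[OF fin sub] card_nth_roots[OF c' pos] by simp
qed

text \<open>For \<open>z \<noteq> 0\<close> the equation amounts to
  \<open>z powi (n - 1) = 1\<close>, which has at most \<bar>n - 1\<bar> solutions. For
  \<open>n \<le> 0\<close> this number equals \<bar>n\<bar> + 1; with \<open>n = - (d - 1)\<close>
  it is the source of the factor \<open>d\<close>.\<close>

lemma powi_fixed_points:
  assumes "n \<noteq> 1"
  shows "finite {z::complex. z \<noteq> 0 \<and> z = z powi n}"
    and "card {z::complex. z \<noteq> 0 \<and> z = z powi n} \<le> nat \<bar>n\<bar> + 1"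
proof -
  have eq: "{z::complex. z \<noteq> 0 \<and> z = z powi n} = {z. z \<noteq> 0 \<and> z powi (n - 1) = 1}"
    by (auto simp: power_int_diff)
  have "nat \<bar>n - 1\<bar> \<le> nat \<bar>n\<bar> + 1" by simp
  then show "finite {z::complex. z \<noteq> 0 \<and> z = z powi n}"
    and "card {z::complex. z \<noteq> 0 \<and> z = z powi n} \<le> nat \<bar>n\<bar> + 1"
    unfolding eq using powi_roots[of "n - 1" 1] assms by auto
qed

text \<open>The exponent may vary with the index because eliminating an unknown multiplies two
  exponents. Solutions are extensional on \<open>S\<close> so that they can be counted.\<close>

definition monomial_sols :: "'a set \<Rightarrow> ('a \<Rightarrow> 'a) \<Rightarrow> ('a \<Rightarrow> int) \<Rightarrow> ('a \<Rightarrow> complex) set" where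
  "monomial_sols S \<phi> f = {t \<in> S \<rightarrow>\<^sub>E UNIV. \<forall>a\<in>S. t a \<noteq> 0 \<and> t (\<phi> a) = t a powi f a}"

text \<open>No other index is mapped to \<open>a\<close>, so the unknown at \<open>a\<close> occurs
  in its own equation only. Once the remaining unknowns \<open>u\<close> are known, its value is
  either a fixed point of a power map (if \<open>\<phi> a = a\<close>) or a root of the known number
  \<open>u (\<phi> a)\<close>; \<open>Z u\<close> collects these values.\<close>

lemma monomial_sols_remove:
  assumes "finite S" "a \<in> S" "\<phi> ` S \<subseteq> S" "\<phi> ` (S - {a}) \<subseteq> S - {a}" "\<bar>f a\<bar> \<ge> 2"
    and fin: "finite (monomial_sols (S - {a}) \<phi> f)"
  shows "finite (monomial_sols S \<phi> f)"
    and "card (monomial_sols S \<phi> f) \<le> card (monomial_sols (S - {a}) \<phi> f) * (nat \<bar>f a\<bar> + 1)"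
proof -
  let ?X = "monomial_sols S \<phi> f" and ?Y = "monomial_sols (S - {a}) \<phi> f"
  define Z where "Z u = (if \<phi> a = a then {z. z \<noteq> 0 \<and> z = z powi f a}
     else {z. z \<noteq> 0 \<and> z powi f a = u (\<phi> a)})" for u :: "'a \<Rightarrow> complex"
  have Z: "finite (Z u) \<and> card (Z u) \<le> nat \<bar>f a\<bar> + 1" if "u \<in> ?Y" for u
  proof (cases "\<phi> a = a")
    case True
    then show ?thesis using powi_fixed_points[of "f a"] assms(5) by (auto simp: Z_def)
  next
    case False
    then have "u (\<phi> a) \<noteq> 0" using that assms(2,3) by (auto simp: monomial_sols_def)
    then show ?thesis using powi_roots[of "f a" "u (\<phi> a)"] assms(5) False
      by (auto simp: Z_def intro: le_SucI)
  qed
  have sub: "?X \<subseteq> (\<lambda>(u, z). u(a := z)) ` (SIGMA u:?Y. Z u)"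
  proof
    fix t assume t: "t \<in> ?X"
    have "restrict t (S - {a}) \<in> ?Y"
      using t assms(4) by (auto simp: monomial_sols_def image_subset_iff)
    moreover have "t a \<in> Z (restrict t (S - {a}))"
      using t assms(2,3) by (auto simp: monomial_sols_def Z_def)
    moreover have "t = (restrict t (S - {a}))(a := t a)"
      using t by (auto simp: monomial_sols_def fun_eq_iff PiE_def extensional_def)
    ultimately show "t \<in> (\<lambda>(u, z). u(a := z)) ` (SIGMA u:?Y. Z u)"
      by (intro image_eqI[where x = "(restrict t (S - {a}), t a)"]) auto
  qed
  have finS: "finite (SIGMA u:?Y. Z u)" using fin Z by auto
  show "finite ?X" using finite_subset[OF sub] finS by blast
  have "card ?X \<le> card (SIGMA u:?Y. Z u)"
    using surj_card_le[OF finS sub] .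
  also have "\<dots> = (\<Sum>u\<in>?Y. card (Z u))" using fin Z by (simp add: card_SigmaI)
  also have "\<dots> \<le> (\<Sum>u\<in>?Y. nat \<bar>f a\<bar> + 1)" by (rule sum_mono) (use Z in blast)
  finally show "card ?X \<le> card ?Y * (nat \<bar>f a\<bar> + 1)" by simp
qed

text \<open>By induction on the size of \<open>S\<close>: an index that is not the image of another
  one is removed directly. If there is none, two consecutive equations are merged into one whose
  exponent is the product, and \<bar>pq\<bar> + 1 \<le> (\<bar>p\<bar> + 1)(\<bar>q\<bar> + 1) keeps
  the bound intact.\<close>

lemma monomial_sols_card:
  assumes "finite S" "\<phi> ` S \<subseteq> S" "\<And>a. a \<in> S \<Longrightarrow> \<bar>f a\<bar> \<ge> 2"
  shows "finite (monomial_sols S \<phi> f) \<and> card (monomial_sols S \<phi> f) \<le> (\<Prod>a\<in>S. nat \<bar>f a\<bar> + 1)"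
  using assms
proof (induction "card S" arbitrary: S \<phi> f rule: less_induct)
  case less
  consider "S = {}" | a where "a \<in> S" "\<phi> ` (S - {a}) \<subseteq> S - {a}"
    | "S \<noteq> {}" "\<And>a. a \<in> S \<Longrightarrow> \<not> \<phi> ` (S - {a}) \<subseteq> S - {a}" by blast
  then show ?case
  proof cases
    case 1
    then show ?thesis by (auto simp: monomial_sols_def)
  next
    case 2
    have IH: "finite (monomial_sols (S - {a}) \<phi> f)"
      "card (monomial_sols (S - {a}) \<phi> f) \<le> (\<Prod>a\<in>S - {a}. nat \<bar>f a\<bar> + 1)"
      using less.hyps[OF card_Diff1_less[OF less.prems(1) 2(1)] _ 2(2)] less.prems(1,3) by auto
    have rem: "finite (monomial_sols S \<phi> f)"
      "card (monomial_sols S \<phi> f) \<le> card (monomial_sols (S - {a}) \<phi> f) * (nat \<bar>f a\<bar> + 1)"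
      using monomial_sols_remove[OF less.prems(1) 2(1) less.prems(2) 2(2) _ IH(1)]
        less.prems(3)[OF 2(1)] by blast+
    note rem(2)
    also have "\<dots> \<le> (\<Prod>a\<in>S - {a}. nat \<bar>f a\<bar> + 1) * (nat \<bar>f a\<bar> + 1)"
      using IH(2) by (rule mult_le_mono1)
    also have "\<dots> = (\<Prod>a\<in>S. nat \<bar>f a\<bar> + 1)"
      using prod.remove[OF less.prems(1) 2(1), of "\<lambda>a. nat \<bar>f a\<bar> + 1"] by (simp only: mult.commute)
    finally show ?thesis using rem(1) by simp
  next
    case 3
    \<comment> \<open>Every index is the image of a different one. By finiteness
      \<open>\<phi>\<close> is then injective on \<open>S\<close>, and injectivity rules out fixed
      points.\<close>
    have "a \<in> \<phi> ` (S - {a})" if "a \<in> S" for a using 3(2)[OF that] less.prems(2) by blast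
    then have surj: "S \<subseteq> \<phi> ` S" and nofix: "\<And>a. a \<in> S \<Longrightarrow> \<phi> a \<noteq> a"
    proof -
      show "S \<subseteq> \<phi> ` S" using \<open>\<And>a. a \<in> S \<Longrightarrow> a \<in> \<phi> ` (S - {a})\<close> by blast
      then have inj: "inj_on \<phi> S" using less.prems(1) by (simp add: finite_surj_inj)
      fix a assume "a \<in> S"
      then obtain b where "b \<in> S" "b \<noteq> a" "\<phi> b = a"
        using \<open>\<And>a. a \<in> S \<Longrightarrow> a \<in> \<phi> ` (S - {a})\<close> by blast
      then show "\<phi> a \<noteq> a" using inj \<open>a \<in> S\<close> by (auto simp: inj_on_def)
    qed
    have inj: "inj_on \<phi> S" using less.prems(1) surj by (simp add: finite_surj_inj)
    obtain a where a: "a \<in> S" using 3 by blast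
    \<comment> \<open>Here \<open>\<phi>\<close> is a permutation without fixed points; eliminate the unknown \<open>t b = t a powi f a\<close>.\<close>
    define b where "b = \<phi> a"
    have b: "b \<in> S" "b \<noteq> a" using a less.prems(2) nofix by (auto simp: b_def)
    \<comment> \<open>The new map skips \<open>b\<close>. If \<open>a\<close> and \<open>b\<close>
      form a 2-cycle, \<open>a\<close> becomes a fixed point of \<open>\<phi>'\<close>, which is
      harmless since the merged exponent has absolute value at least 2.\<close>
    define \<phi>' where "\<phi>' = \<phi>(a := \<phi> b)"
    define f' where "f' = f(a := f a * f b)"
    have \<phi>': "\<phi>' ` (S - {b}) \<subseteq> S - {b}"
      using less.prems(2) inj a b nofix by (auto simp: \<phi>'_def b_def inj_on_def)
    have abs2: "\<bar>f a\<bar> \<ge> 2" "\<bar>f b\<bar> \<ge> 2" using a b less.prems(3) by auto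
    have "2 * 1 \<le> \<bar>f a\<bar> * \<bar>f b\<bar>" using abs2 by (intro mult_mono) auto
    then have f': "\<bar>f' c\<bar> \<ge> 2" if "c \<in> S - {b}" for c
      using less.prems(3) that by (auto simp: f'_def abs_mult)
    have IH: "finite (monomial_sols (S - {b}) \<phi>' f')"
      "card (monomial_sols (S - {b}) \<phi>' f') \<le> (\<Prod>c\<in>S - {b}. nat \<bar>f' c\<bar> + 1)"
      using less.hyps[OF card_Diff1_less[OF less.prems(1) b(1)] _ \<phi>', of f'] less.prems(1) f' by auto
    let ?r = "\<lambda>t. restrict t (S - {b})"
    have sub: "?r ` monomial_sols S \<phi> f \<subseteq> monomial_sols (S - {b}) \<phi>' f'"
    proof (rule image_subsetI)
      fix t assume t: "t \<in> monomial_sols S \<phi> f"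
      have "?r t c \<noteq> 0 \<and> ?r t (\<phi>' c) = ?r t c powi f' c" if c: "c \<in> S - {b}" for c
      proof -
        have "\<phi>' c \<in> S - {b}" using \<phi>' c by blast
        moreover have "t (\<phi> b) = t a powi (f a * f b)"
          using t a b by (auto simp: monomial_sols_def b_def power_int_mult)
        ultimately show ?thesis using t c a
          by (auto simp: monomial_sols_def \<phi>'_def f'_def)
      qed
      then show "?r t \<in> monomial_sols (S - {b}) \<phi>' f'" by (auto simp: monomial_sols_def)
    qed
    have injr: "inj_on ?r (monomial_sols S \<phi> f)"
    proof (rule inj_onI)
      fix t u assume t: "t \<in> monomial_sols S \<phi> f" and u: "u \<in> monomial_sols S \<phi> f"
        and eq: "?r t = ?r u"
      have off: "t c = u c" if "c \<in> S - {b}" for c using fun_cong[OF eq, of c] that by simp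
      moreover have "t b = u b" using t u a b off[of a] by (auto simp: monomial_sols_def b_def)
      ultimately have "\<And>c. c \<in> S \<Longrightarrow> t c = u c" by blast
      then show "t = u" using t u by (auto simp: monomial_sols_def intro: PiE_ext)
    qed
    have fin: "finite (monomial_sols S \<phi> f)" using inj_on_finite[OF injr sub IH(1)] .
    have "nat \<bar>f a * f b\<bar> + 1 \<le> (nat \<bar>f a\<bar> + 1) * (nat \<bar>f b\<bar> + 1)"
      by (simp add: abs_mult nat_mult_distrib)
    then have "(\<Prod>c\<in>S - {b}. nat \<bar>f' c\<bar> + 1) \<le> (nat \<bar>f a\<bar> + 1) * (nat \<bar>f b\<bar> + 1) * (\<Prod>c\<in>S - {b} - {a}. nat \<bar>f' c\<bar> + 1)"
      using prod.remove[of "S - {b}" a "\<lambda>c. nat \<bar>f' c\<bar> + 1"] a b less.prems(1)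
      by (simp add: f'_def)
    also have "(\<Prod>c\<in>S - {b} - {a}. nat \<bar>f' c\<bar> + 1) = (\<Prod>c\<in>S - {b} - {a}. nat \<bar>f c\<bar> + 1)"
      by (rule prod.cong) (auto simp: f'_def)
    also have "(nat \<bar>f a\<bar> + 1) * (nat \<bar>f b\<bar> + 1) * \<dots> = (\<Prod>c\<in>S. nat \<bar>f c\<bar> + 1)"
      using prod.remove[of S b "\<lambda>c. nat \<bar>f c\<bar> + 1"] prod.remove[of "S - {b}" a "\<lambda>c. nat \<bar>f c\<bar> + 1"]
        a b less.prems(1) by (simp add: algebra_simps)
    finally show ?thesis using fin IH(2) card_inj_on_le[OF injr sub IH(1)] by linarith
  qed
qed

section \<open>Forms and their derivatives\<close>

definition eval_monom :: "('n::finite \<Rightarrow>\<^sub>0 nat) \<Rightarrow> complex ^ 'n \<Rightarrow> complex" where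
  "eval_monom m x = (\<Prod>i\<in>UNIV. (x $ i) ^ Poly_Mapping.lookup m i)"

text \<open>Allows polynomials with different sets of monomials to be summed over one common index
  set.\<close>

lemma eval_poly_superset:
  assumes "finite S" "Poly_Mapping.keys F \<subseteq> S"
  shows "eval_poly F x = (\<Sum>m\<in>S. Poly_Mapping.lookup F m * eval_monom m x)"
  unfolding eval_poly_def eval_monom_def
  by (rule sum.mono_neutral_left) (use assms in \<open>auto simp: in_keys_iff\<close>)

lemma eval_poly_0 [simp]: "eval_poly 0 x = 0"
  by (simp add: eval_poly_def)

lemma eval_poly_single [simp]: "eval_poly (Poly_Mapping.single m c) x = c * eval_monom m x"
  by (subst eval_poly_superset[of "{m}"]) auto

lemma eval_poly_add [simp]: "eval_poly (F + H) x = eval_poly F x + eval_poly H x"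
proof -
  let ?S = "Poly_Mapping.keys F \<union> Poly_Mapping.keys H"
  have "eval_poly (F + H) x = (\<Sum>m\<in>?S. Poly_Mapping.lookup (F + H) m * eval_monom m x)"
    by (rule eval_poly_superset) (simp_all add: Poly_Mapping.keys_add)
  then show ?thesis
    by (simp add: lookup_add distrib_right sum.distrib eval_poly_superset[of ?S])
qed

lemma eval_poly_sum [simp]: "eval_poly (\<Sum>a\<in>A. f a) x = (\<Sum>a\<in>A. eval_poly (f a) x)"
  by (induction A rule: infinite_finite_induct) auto

lemma eval_monom_add: "eval_monom (m + l) x = eval_monom m x * eval_monom l x"
  by (simp add: eval_monom_def lookup_add power_add prod.distrib)

lemma poly_mapping_decomp:
  "F = (\<Sum>m\<in>Poly_Mapping.keys F. Poly_Mapping.single m (Poly_Mapping.lookup F m))"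
  by (rule poly_mapping_eqI) (auto simp: lookup_sum lookup_single when_def in_keys_iff)

lemma eval_poly_mult [simp]: "eval_poly (F * H) x = eval_poly F x * eval_poly H x"
proof -
  have "F * H = (\<Sum>m\<in>Poly_Mapping.keys F. \<Sum>l\<in>Poly_Mapping.keys H.
      Poly_Mapping.single (m + l) (Poly_Mapping.lookup F m * Poly_Mapping.lookup H l))"
    by (subst (1) poly_mapping_decomp[of F], subst (1) poly_mapping_decomp[of H])
       (simp add: sum_product mult_single)
  then have "eval_poly (F * H) x = (\<Sum>m\<in>Poly_Mapping.keys F. \<Sum>l\<in>Poly_Mapping.keys H.
      Poly_Mapping.lookup F m * eval_monom m x * (Poly_Mapping.lookup H l * eval_monom l x))"
    by (simp add: eval_monom_add mult_ac)
  then show ?thesis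
    by (simp add: eval_poly_superset[of "Poly_Mapping.keys F" F] eval_poly_superset[of "Poly_Mapping.keys H" H] sum_product)
qed

lemma eval_monom_0 [simp]: "eval_monom 0 x = 1"
  by (simp add: eval_monom_def)

lemma eval_poly_1 [simp]: "eval_poly 1 x = 1"
  by (simp flip: single_one)

lemma eval_poly_prod [simp]: "eval_poly (\<Prod>a\<in>A. f a) x = (\<Prod>a\<in>A. eval_poly (f a) x)"
  by (induction A rule: infinite_finite_induct) auto

lemma eval_poly_power [simp]: "eval_poly (F ^ n) x = eval_poly F x ^ n"
  by (induction n) auto

lemma eval_const_poly [simp]: "eval_poly (const_poly c) x = c"
  by (simp add: const_poly_def)

lemma eval_var_poly [simp]: "eval_poly (var_poly i) x = x $ i"
proof -
  have "eval_monom (Poly_Mapping.single i 1) x = (\<Prod>j\<in>UNIV. if j = i then x $ j else 1)"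
    unfolding eval_monom_def by (rule prod.cong) (auto simp: lookup_single when_def)
  then show ?thesis by (simp add: var_poly_def)
qed

lemma eval_lin_subst: "eval_poly (lin_subst A F) x = eval_poly F (A *v x)"
  by (simp add: lin_subst_def matrix_vector_mult_def eval_poly_def[of F])

text \<open>This is the directional derivative D F(x)(w). It is built from the formal partial
  derivatives, so that smoothness applies to it directly;
  \<open>has_derivative_eval_poly_line\<close> identifies it with the analytic derivative along a
  line.\<close>

definition dpoly :: "'n::finite cpoly \<Rightarrow> complex ^ 'n \<Rightarrow> complex ^ 'n \<Rightarrow> complex" where
  "dpoly F x w = (\<Sum>i\<in>UNIV. w $ i * eval_poly (partial_deriv i F) x)"

lemma has_derivative_eval_monom_line:
  fixes x w :: "complex ^ 'n::finite"
  shows "((\<lambda>t. eval_monom m (x + t *s w)) has_field_derivative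
    (\<Sum>i\<in>UNIV. w $ i * (of_nat (Poly_Mapping.lookup m i) * eval_monom (m - Poly_Mapping.single i 1) x))) (at 0)"
proof -
  let ?l = "Poly_Mapping.lookup m"
  have "((\<lambda>t. eval_monom m (x + t *s w)) has_field_derivative
    (\<Sum>i\<in>UNIV. (of_nat (?l i) * (x + 0 *s w) $ i ^ (?l i - 1) * w $ i) * (\<Prod>j\<in>UNIV - {i}. (x + 0 *s w) $ j ^ ?l j))) (at 0)"
    unfolding eval_monom_def
  proof (rule has_field_derivative_prod)
    fix i
    have "((\<lambda>t. (x $ i + t * w $ i) ^ ?l i) has_field_derivative
      of_nat (?l i) * (x $ i + 0 * w $ i) ^ (?l i - 1) * w $ i) (at 0)"
      by (auto intro!: derivative_eq_intros)
    then show "((\<lambda>t. (x + t *s w) $ i ^ ?l i) has_field_derivative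
      of_nat (?l i) * (x + 0 *s w) $ i ^ (?l i - 1) * w $ i) (at 0)" by simp
  qed
  also have "(\<Sum>i\<in>UNIV. (of_nat (?l i) * (x + 0 *s w) $ i ^ (?l i - 1) * w $ i) * (\<Prod>j\<in>UNIV - {i}. (x + 0 *s w) $ j ^ ?l j))
     = (\<Sum>i\<in>UNIV. w $ i * (of_nat (?l i) * eval_monom (m - Poly_Mapping.single i 1) x))"
  proof (rule sum.cong[OF refl])
    fix i
    \<comment> \<open>Subtraction truncates in the same way here and in the power rule, so variables
      that are absent from \<open>m\<close> fit in as well.\<close>
    have "eval_monom (m - Poly_Mapping.single i 1) x = (x $ i) ^ (?l i - 1) * (\<Prod>j\<in>UNIV - {i}. (x $ j) ^ ?l j)"
      unfolding eval_monom_def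
      by (subst prod.remove[of UNIV i]) (auto simp: lookup_minus lookup_single when_def intro!: prod.cong)
    then show "(of_nat (?l i) * (x + 0 *s w) $ i ^ (?l i - 1) * w $ i) * (\<Prod>j\<in>UNIV - {i}. (x + 0 *s w) $ j ^ ?l j)
       = w $ i * (of_nat (?l i) * eval_monom (m - Poly_Mapping.single i 1) x)"
      by simp
  qed
  finally show ?thesis .
qed

lemma eval_partial_deriv:
  "eval_poly (partial_deriv i F) x = (\<Sum>m\<in>Poly_Mapping.keys F. Poly_Mapping.lookup F m *
     (of_nat (Poly_Mapping.lookup m i) * eval_monom (m - Poly_Mapping.single i 1) x))"
  by (simp add: partial_deriv_def mult_ac)

lemma has_derivative_eval_poly_line:
  "((\<lambda>t. eval_poly F (x + t *s w)) has_field_derivative dpoly F x w) (at 0)"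
proof -
  let ?K = "Poly_Mapping.keys F"
  have "((\<lambda>t. \<Sum>m\<in>?K. Poly_Mapping.lookup F m * eval_monom m (x + t *s w)) has_field_derivative
    (\<Sum>m\<in>?K. Poly_Mapping.lookup F m * (\<Sum>i\<in>UNIV. w $ i * (of_nat (Poly_Mapping.lookup m i) * eval_monom (m - Poly_Mapping.single i 1) x)))) (at 0)"
    by (intro DERIV_sum DERIV_cmult has_derivative_eval_monom_line)
  also have "(\<Sum>m\<in>?K. Poly_Mapping.lookup F m * (\<Sum>i\<in>UNIV. w $ i * (of_nat (Poly_Mapping.lookup m i) * eval_monom (m - Poly_Mapping.single i 1) x))) = dpoly F x w"
    unfolding dpoly_def eval_partial_deriv sum_distrib_left
    by (subst sum.swap) (simp add: mult_ac)
  finally show ?thesis by (simp add: eval_poly_superset[of ?K F])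
qed

text \<open>Both sides are the derivative at \<open>t = 0\<close> of one and the same function,
  because F(A(x + t w)) = F(x + t w) for all \<open>t\<close>.\<close>

lemma dpoly_invariant:
  assumes "lin_subst A F = F"
  shows "dpoly F (A *v x) (A *v w) = dpoly F x w"
proof -
  have "eval_poly F (A *v x + t *s (A *v w)) = eval_poly F (x + t *s w)" for t
    using eval_lin_subst[of A F "x + t *s w"] assms
    by (simp add: matrix_vector_right_distrib vector_scalar_commute)
  then show ?thesis
    using has_derivative_eval_poly_line[of F "A *v x" "A *v w"] has_derivative_eval_poly_line[of F x w]
    by (simp add: DERIV_unique)
qed

lemma dpoly_add: "dpoly F x (v + w) = dpoly F x v + dpoly F x w"
  by (simp add: dpoly_def distrib_right sum.distrib)

lemma dpoly_scale: "dpoly F x (c *s w) = c * dpoly F x w"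
  by (simp add: dpoly_def sum_distrib_left mult_ac)

lemma eval_partial_deriv_scale:
  assumes "form_of_degree d F"
  shows "eval_poly (partial_deriv i F) (c *s x) = c ^ (d - 1) * eval_poly (partial_deriv i F) x"
proof -
  have "of_nat (Poly_Mapping.lookup m i) * eval_monom (m - Poly_Mapping.single i 1) (c *s x)
     = c ^ (d - 1) * (of_nat (Poly_Mapping.lookup m i) * eval_monom (m - Poly_Mapping.single i 1) x)"
    if m: "m \<in> Poly_Mapping.keys F" for m
  \<comment> \<open>If the variable does not occur in \<open>m\<close>, truncation leaves a monomial
    of degree \<open>d\<close> instead of \<open>d - 1\<close>, but its coefficient is 0.\<close>
  proof (cases "Poly_Mapping.lookup m i = 0")
    case False
    let ?m = "m - Poly_Mapping.single i 1"
    have "(\<Sum>j\<in>UNIV. Poly_Mapping.lookup m j) = d" using assms m by (simp add: form_of_degree_def)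
    moreover have "(\<Sum>j\<in>UNIV. Poly_Mapping.lookup m j) =
        (\<Sum>j\<in>UNIV. Poly_Mapping.lookup ?m j + (if j = i then 1 else 0))"
      by (rule sum.cong) (use False in \<open>auto simp: lookup_minus lookup_single when_def\<close>)
    ultimately have "(\<Sum>j\<in>UNIV. Poly_Mapping.lookup ?m j) = d - 1"
      by (simp add: sum.distrib del: One_nat_def)
    then have "eval_monom ?m (c *s x) = c ^ (d - 1) * eval_monom ?m x"
      by (simp add: eval_monom_def power_mult_distrib prod.distrib flip: power_sum)
    then show ?thesis by simp
  qed simp
  then show ?thesis
    unfolding eval_partial_deriv sum_distrib_left
    by (intro sum.cong refl) (simp only: mult.left_commute[of _ "c ^ (d - 1)"])
qed

lemma dpoly_scale_point:
  "form_of_degree d F \<Longrightarrow> dpoly F (c *s x) w = c ^ (d - 1) * dpoly F x w"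
  by (simp add: dpoly_def eval_partial_deriv_scale sum_distrib_left mult_ac)

lemma dpoly_nonzero:
  assumes "smooth_form F" "x \<noteq> 0"
  shows "\<exists>w. dpoly F x w \<noteq> 0"
proof -
  obtain i where i: "eval_poly (partial_deriv i F) x \<noteq> 0"
    using assms by (auto simp: smooth_form_def)
  have "dpoly F x (axis i 1) = (\<Sum>j\<in>UNIV. if j = i then eval_poly (partial_deriv j F) x else 0)"
    unfolding dpoly_def by (rule sum.cong) (auto simp: axis_def)
  with i have "dpoly F x (axis i 1) \<noteq> 0" by simp
  then show ?thesis ..
qed

section \<open>Traces of powers\<close>

text \<open>Carries the Schur decomposition over to matrices indexed by a finite type. The injection
  \<open>g\<close> numbers the indices and so supplies the order with respect to which
  \<open>T\<close> is upper triangular; the last clause says that the diagonal of \<open>T\<close>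
  lists precisely the eigenvalues.\<close>

lemma schur_triangular:
  fixes A :: "complex ^ 'n::finite ^ 'n"
  obtains P T Q and g :: "'n \<Rightarrow> nat"
  where "A = P ** T ** Q" "Q ** P = mat 1" "\<And>i j. g j < g i \<Longrightarrow> T $ i $ j = 0" "inj g"
    "\<And>\<mu>. (\<exists>v. v \<noteq> 0 \<and> A *v v = \<mu> *s v) \<longleftrightarrow> (\<exists>i. T $ i $ i = \<mu>)"
proof -
  define n where "n = CARD('n)"
  obtain f where f: "bij_betw f {0..<n} (UNIV :: 'n set)"
    using ex_bij_betw_nat_finite[of "UNIV :: 'n set"] by (auto simp: n_def)
  define g where "g = the_inv_into {0..<n} f"
  have fg: "f (g i) = i" for i
    using f by (simp add: g_def f_the_inv_into_f_bij_betw)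
  have gf: "g (f k) = k" if "k < n" for k
    using f that by (simp add: g_def the_inv_into_f_f bij_betw_def)
  have g: "bij_betw g UNIV {0..<n}"
    using f by (simp add: g_def bij_betw_the_inv_into)
  then have gn: "g i < n" for i by (auto simp: bij_betw_def)
  define M where "M = Matrix.mat n n (\<lambda>(i, j). A $ f i $ f j)"
  have M: "M \<in> carrier_mat n n" by (simp add: M_def)
  \<comment> \<open>\<open>bk\<close> translates matrices indexed by numbers back to the index type;
    it is multiplicative and inverts the passage from \<open>A\<close> to \<open>M\<close>.\<close>
  define bk where "bk X = (\<chi> i j. X $$ (g i, g j))" for X :: "complex Matrix.mat"
  have bk_mult: "bk (X * Y) = bk X ** bk Y"
    if "X \<in> carrier_mat n n" "Y \<in> carrier_mat n n" for X Y
  proof -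
    have "(X * Y) $$ (g i, g j) = (\<Sum>k\<in>UNIV. X $$ (g i, g k) * Y $$ (g k, g j))" for i j
    proof -
      have "(X * Y) $$ (g i, g j) = (\<Sum>k\<in>{0..<n}. X $$ (g i, k) * Y $$ (k, g j))"
        using that gn by (simp add: scalar_prod_def)
      then show ?thesis
        using sum.reindex_bij_betw[OF g, of "\<lambda>k. X $$ (g i, k) * Y $$ (k, g j)"] by simp
    qed
    then show ?thesis by (simp add: bk_def matrix_matrix_mult_def)
  qed
  have bk_M: "bk M = A" using gn by (simp add: bk_def M_def fg vec_eq_iff)
  obtain as where as: "char_poly M = (\<Prod>a\<leftarrow>as. [:- a, 1:])" using char_poly_factorized[OF M] by blast
  obtain B P Q where "schur_decomposition M as = (B, P, Q)" by (cases "schur_decomposition M as")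
  from schur_decomposition[OF M as this]
  have wit: "similar_mat_wit M B P Q" and ut: "upper_triangular B" and diag: "diag_mat B = as" by auto
  from similar_mat_witD2[OF M wit]
  have B: "B \<in> carrier_mat n n" and P: "P \<in> carrier_mat n n" and Q: "Q \<in> carrier_mat n n"
    and QP: "Q * P = 1\<^sub>m n" and eq: "M = P * B * Q" by auto
  show ?thesis
  proof (rule that)
    show "A = bk P ** bk B ** bk Q"
      using bk_mult[of "P * B" Q] bk_mult[OF P B] P B Q bk_M unfolding eq by simp
    have "bk Q ** bk P = bk (1\<^sub>m n)" using bk_mult[OF Q P] QP by simp
    also have "\<dots> = mat 1"
      using gn g by (auto simp: bk_def Finite_Cartesian_Product.mat_def vec_eq_iff bij_betw_def inj_def)
    finally show "bk Q ** bk P = mat 1" .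
    show "bk B $ i $ j = 0" if "g j < g i" for i j
      using upper_triangularD[OF ut that] B gn by (simp add: bk_def)
    show "inj g" using g by (simp add: bij_betw_def)
    fix \<mu>
    have "(\<exists>v. v \<noteq> 0 \<and> A *v v = \<mu> *s v) \<longleftrightarrow> eigenvalue M \<mu>"
    proof
      assume "\<exists>v. v \<noteq> 0 \<and> A *v v = \<mu> *s v"
      then obtain v where v: "v \<noteq> 0" "A *v v = \<mu> *s v" by blast
      define x where "x = Matrix.vec n (\<lambda>k. v $ f k)"
      have "x \<noteq> 0\<^sub>v n"
      proof
        assume "x = 0\<^sub>v n"
        then have "vec_index x (g i) = 0" for i using gn by simp
        then have "v = 0" using gn by (simp add: x_def fg vec_eq_iff)
        with v show False by simp
      qed
      moreover have "M *\<^sub>v x = \<mu> \<cdot>\<^sub>v x"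
      proof (rule eq_vecI)
        fix k assume "k < dim_vec (\<mu> \<cdot>\<^sub>v x)"
        then have k: "k < n" by (simp add: x_def)
        have "vec_index (M *\<^sub>v x) k = (\<Sum>j\<in>{0..<n}. A $ f k $ f j * v $ f j)"
          using k M by (simp add: scalar_prod_def M_def x_def)
        also have "\<dots> = (A *v v) $ f k"
          using sum.reindex_bij_betw[OF f, of "\<lambda>j. A $ f k $ j * v $ j"]
          by (simp add: matrix_vector_mult_def)
        finally show "vec_index (M *\<^sub>v x) k = vec_index (\<mu> \<cdot>\<^sub>v x) k"
          using k v(2) by (simp add: x_def)
      qed (simp add: x_def M_def)
      ultimately show "eigenvalue M \<mu>"
        unfolding eigenvalue_def eigenvector_def using M by (intro exI[of _ x]) (auto simp: x_def)
    next
      assume "eigenvalue M \<mu>"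
      then obtain x where x: "x \<in> carrier_vec n" "x \<noteq> 0\<^sub>v n" "M *\<^sub>v x = \<mu> \<cdot>\<^sub>v x"
        unfolding eigenvalue_def eigenvector_def using M by auto
      define v where "v = (\<chi> i. vec_index x (g i))"
      have "v \<noteq> 0"
      proof
        assume "v = 0"
        then have "vec_index x (g i) = 0" for i by (simp add: v_def vec_eq_iff)
        then have "vec_index x k = 0" if "k < n" for k using gf[OF that] by metis
        then have "x = 0\<^sub>v n" using x(1) by (intro eq_vecI) auto
        with x show False by simp
      qed
      moreover have "(A *v v) $ i = \<mu> * v $ i" for i
      proof -
        have "(A *v v) $ i = (\<Sum>j\<in>{0..<n}. A $ i $ f j * vec_index x j)"
          using sum.reindex_bij_betw[OF g, of "\<lambda>j. A $ i $ f j * vec_index x j"]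
          by (simp add: matrix_vector_mult_def v_def fg)
        also have "\<dots> = vec_index (M *\<^sub>v x) (g i)"
          using gn x(1) by (simp add: M_def scalar_prod_def fg)
        finally show ?thesis using x gn by (simp add: v_def)
      qed
      ultimately show "\<exists>v. v \<noteq> 0 \<and> A *v v = \<mu> *s v" by (auto simp: vec_eq_iff intro!: exI[of _ v])
    qed
    also have "\<dots> \<longleftrightarrow> \<mu> \<in> set as"
      unfolding eigenvalue_root_char_poly[OF M] as by (auto simp: poly_prod_list prod_list_zero_iff)
    also have "\<dots> \<longleftrightarrow> (\<exists>i. bk B $ i $ i = \<mu>)"
    proof -
      have "set as = (\<lambda>k. B $$ (k, k)) ` (g ` UNIV)"
        using g B by (auto simp: diag[symmetric] diag_mat_def bij_betw_def)
      then show ?thesis by (auto simp: bk_def)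
    qed
    finally show "(\<exists>v. v \<noteq> 0 \<and> A *v v = \<mu> *s v) \<longleftrightarrow> (\<exists>i. bk B $ i $ i = \<mu>)" .
  qed
qed

definition eigenvalues :: "complex ^ 'n ^ 'n \<Rightarrow> complex set" where
  "eigenvalues A = {\<mu>. \<exists>v. v \<noteq> 0 \<and> A *v v = \<mu> *s v}"

definition matpow :: "complex ^ 'n ^ 'n \<Rightarrow> nat \<Rightarrow> complex ^ 'n ^ 'n" where
  "matpow A k = ((**) A ^^ k) (mat 1)"

lemma matpow_simps [simp]: "matpow A 0 = mat 1" "matpow A (Suc k) = A ** matpow A k"
  by (simp_all add: matpow_def)

text \<open>A nonzero term of the entry at \<open>i\<close>, \<open>j\<close> of a product needs an
  index \<open>l\<close> with \<open>g i \<le> g l \<le> g j\<close>. Below the diagonal there is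
  none, and on the diagonal only \<open>l = i\<close>.\<close>

lemma matpow_triangular:
  fixes g :: "'n::finite \<Rightarrow> nat"
  assumes "inj g" and T: "\<And>i j. g j < g i \<Longrightarrow> T $ i $ j = 0"
  shows "(\<forall>i j. g j < g i \<longrightarrow> matpow T k $ i $ j = 0) \<and> (\<forall>i. matpow T k $ i $ i = (T $ i $ i) ^ k)"
proof (induction k)
  case 0
  then show ?case by (auto simp: Finite_Cartesian_Product.mat_def)
next
  case (Suc k)
  have entry: "matpow T (Suc k) $ i $ j = (\<Sum>l\<in>UNIV. T $ i $ l * matpow T k $ l $ j)" for i j
    by (simp add: matrix_matrix_mult_def)
  have "T $ i $ l * matpow T k $ l $ j = 0" if "g j < g i" for i j l
    using Suc T[of l i] that by (cases "g l < g i") auto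
  moreover have "matpow T (Suc k) $ i $ i = (T $ i $ i) ^ Suc k" for i
  proof -
    have "T $ i $ l * matpow T k $ l $ i = (if l = i then (T $ i $ i) ^ Suc k else 0)" for l
      using Suc T[of l i] assms(1) by (cases "g l" "g i" rule: linorder_cases) (auto simp: inj_eq)
    then show ?thesis unfolding entry by simp
  qed
  ultimately show ?case unfolding entry by auto
qed

text \<open>The function \<open>e\<close> lists the eigenvalues with multiplicity: it is the
  diagonal of a triangular conjugate of \<open>A\<close>, and conjugation preserves the traces of
  powers.\<close>

lemma trace_matpow:
  fixes A :: "complex ^ 'n::finite ^ 'n"
  obtains e :: "'n \<Rightarrow> complex"
  where "range e = eigenvalues A" "\<And>k. trace (matpow A k) = (\<Sum>i\<in>UNIV. e i ^ k)"
proof -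
  obtain P T Q and g :: "'n \<Rightarrow> nat"
    where A: "A = P ** T ** Q" and QP: "Q ** P = mat 1"
      and T: "\<And>i j. g j < g i \<Longrightarrow> T $ i $ j = 0" "inj g"
      and ev: "\<And>\<mu>. (\<exists>v. v \<noteq> 0 \<and> A *v v = \<mu> *s v) \<longleftrightarrow> (\<exists>i. T $ i $ i = \<mu>)"
    using schur_triangular[of A] by metis
  have PQ: "P ** Q = mat 1" using QP matrix_left_right_inverse by blast
  have pow: "matpow A k = P ** matpow T k ** Q" for k
  proof (induction k)
    case 0
    then show ?case using PQ by simp
  next
    case (Suc k)
    have "matpow A (Suc k) = P ** T ** (Q ** P) ** matpow T k ** Q"
      using Suc by (simp add: A matrix_mul_assoc)
    then show ?case using QP by (simp add: matrix_mul_assoc)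
  qed
  have "trace (matpow A k) = (\<Sum>i\<in>UNIV. (T $ i $ i) ^ k)" for k
  proof -
    have "trace (matpow A k) = trace (Q ** (P ** matpow T k))"
      unfolding pow by (rule trace_mul_sym)
    also have "\<dots> = trace (matpow T k)" using QP by (simp add: matrix_mul_assoc)
    finally show ?thesis using matpow_triangular[OF T(2,1)] by (simp add: trace_def)
  qed
  moreover have "range (\<lambda>i. T $ i $ i) = eigenvalues A"
    using ev by (auto simp: eigenvalues_def)
  ultimately show ?thesis by (rule that[rotated])
qed

lemma finite_eigenvalues: "finite (eigenvalues A)" "card (eigenvalues (A :: complex ^ 'n::finite ^ 'n)) \<le> CARD('n)"
proof -
  obtain e :: "'n \<Rightarrow> complex" where "range e = eigenvalues A" using trace_matpow by metis
  then show "finite (eigenvalues A)" "card (eigenvalues A) \<le> CARD('n)"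
    by (metis finite finite_imageI, metis card_image_le finite)
qed

text \<open>A trace is the sum of a tuple of eigenvalues, and there are only finitely many tuples
  with entries in \<open>L\<close>.\<close>

lemma finite_traces:
  fixes G :: "(complex ^ 'n::finite ^ 'n) set"
  assumes "finite L" "\<And>A. A \<in> G \<Longrightarrow> eigenvalues A \<subseteq> L"
  shows "finite (trace ` G)"
proof (rule finite_subset)
  show "trace ` G \<subseteq> (\<lambda>e. \<Sum>i\<in>UNIV. e i) ` (UNIV \<rightarrow>\<^sub>E L :: ('n \<Rightarrow> complex) set)"
  proof (rule image_subsetI)
    fix A assume "A \<in> G"
    obtain e :: "'n \<Rightarrow> complex"
      where e: "range e = eigenvalues A" "\<And>k. trace (matpow A k) = (\<Sum>i\<in>UNIV. e i ^ k)"
      using trace_matpow[of A] by blast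
    have "trace A = (\<Sum>i\<in>UNIV. e i)" using e(2)[of 1] by simp
    moreover have "e \<in> UNIV \<rightarrow>\<^sub>E L" using e(1) assms(2)[OF \<open>A \<in> G\<close>] by auto
    ultimately show "trace A \<in> (\<lambda>e. \<Sum>i\<in>UNIV. e i) ` (UNIV \<rightarrow>\<^sub>E L :: ('n \<Rightarrow> complex) set)"
      by (rule image_eqI)
  qed
  show "finite ((\<lambda>e. \<Sum>i\<in>UNIV. e i) ` (UNIV \<rightarrow>\<^sub>E L :: ('n \<Rightarrow> complex) set))"
    using assms(1) by (intro finite_imageI finite_PiE) auto
qed

text \<open>The values of a polynomial without constant term sum to 0 over the eigenvalues. A
  polynomial that isolates the eigenvalue 1 would make this sum its multiplicity times a nonzero
  number.\<close>

lemma trace_matpow_zero_imp: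
  assumes "\<And>k. k > 0 \<Longrightarrow> trace (matpow A k) = 0"
  shows "1 \<notin> eigenvalues (A :: complex ^ 'n::finite ^ 'n)"
proof
  assume 1: "1 \<in> eigenvalues A"
  obtain e :: "'n \<Rightarrow> complex"
    where e: "range e = eigenvalues A" "\<And>k. trace (matpow A k) = (\<Sum>i\<in>UNIV. e i ^ k)"
    using trace_matpow[of A] by blast
  have sum0: "(\<Sum>i\<in>UNIV. poly p (e i)) = 0" if "coeff p 0 = 0" for p
  proof -
    have "(\<Sum>i\<in>UNIV. poly p (e i)) = (\<Sum>k\<le>degree p. coeff p k * (\<Sum>i\<in>UNIV. e i ^ k))"
      unfolding poly_altdef sum_distrib_left by (rule sum.swap)
    also have "\<dots> = 0"
    proof (rule sum.neutral, rule ballI)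
      fix k show "coeff p k * (\<Sum>i\<in>UNIV. e i ^ k) = 0"
        using that assms[of k] e(2)[of k] by (cases "k = 0") auto
    qed
    finally show ?thesis .
  qed
  \<comment> \<open>The product vanishes at every eigenvalue other than 1; the factor
    \<open>[:0, 1:]\<close> removes the constant term, as the trace of the zeroth power is not
    0.\<close>
  define p where "p = [:0, 1:] * (\<Prod>b\<in>range e - {1}. [:- b, 1:])"
  have p1: "poly p 1 \<noteq> 0" by (auto simp: p_def poly_prod)
  have "poly p (e i) = (if e i = 1 then poly p 1 else 0)" for i
    by (auto simp: p_def poly_prod)
  then have "(\<Sum>i\<in>UNIV. poly p (e i)) = of_nat (card {i. e i = 1}) * poly p 1"
    by (simp add: sum.If_cases)
  moreover have "{i. e i = 1} \<noteq> {}" using 1 e(1) by (metis (mono_tags) empty_iff mem_Collect_eq rangeE)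
  then have "card {i. e i = 1} \<noteq> 0" by simp
  ultimately show False using sum0[of p] p1 by (simp add: p_def)
qed

section \<open>Finiteness\<close>

lemma mat_scalar_mult: "mat c *v x = c *s (x :: complex ^ 'n::finite)"
proof -
  have "mat c $ i $ j * x $ j = (if j = i then c * x $ j else 0)" for i j
    by (simp add: Finite_Cartesian_Product.mat_def)
  then show ?thesis by (simp add: matrix_vector_mult_def Finite_Cartesian_Product.vec_eq_iff)
qed

text \<open>The matrix \<open>A - mat \<mu>\<close> has trivial kernel, hence is surjective.\<close>

lemma matrix_bij_of_not_eigenvalue:
  fixes A :: "complex ^ 'n::finite ^ 'n"
  assumes "\<mu> \<notin> eigenvalues A"
  shows "\<exists>y. x = A *v y - \<mu> *s y"
proof -
  let ?B = "A - mat \<mu>"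
  have B: "?B *v y = A *v y - \<mu> *s y" for y
    by (simp add: matrix_vector_mult_diff_rdistrib) (simp add: mat_scalar_mult)
  have "y = 0" if "?B *v y = 0" for y
    using that assms by (auto simp: B eigenvalues_def)
  then obtain C where "C ** ?B = mat 1" using matrix_left_invertible_ker[of ?B] by auto
  then have "?B ** C = mat 1" using matrix_left_right_inverse by blast
  then have "x = ?B *v (C *v x)" by (simp add: matrix_vector_mul_assoc)
  then show ?thesis using B by metis
qed

text \<open>Invariance and homogeneity give D F(v)(A w) = \<mu>' D F(v)(w) with
  \<open>\<mu>' = \<mu> powi (- int (d - 1))\<close>, so the functional D F(v) vanishes on the image
  of \<open>A - mat \<mu>'\<close>. If \<open>\<mu>'\<close> were not an eigenvalue, this image
  would be the whole space, against smoothness.\<close>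

lemma eigenvalue_Aut_form:
  assumes F: "form_of_degree d F" "smooth_form F" and A: "A \<in> Aut_form F"
    and \<mu>: "\<mu> \<in> eigenvalues A"
  shows "\<mu> \<noteq> 0" "\<mu> powi (- int (d - 1)) \<in> eigenvalues A"
proof -
  obtain v where v: "v \<noteq> 0" "A *v v = \<mu> *s v" using \<mu> by (auto simp: eigenvalues_def)
  have inv: "lin_subst A F = F" "invertible A" using A by (auto simp: Aut_form_def GL_def)
  show "\<mu> \<noteq> 0"
  proof
    assume "\<mu> = 0"
    then have "A *v v = A *v 0" using v by simp
    then show False using inj_matrix_vector_mult[OF inv(2)] v(1) unfolding inj_eq[OF inj_matrix_vector_mult[OF inv(2)]] by simp
  qed
  then have l: "dpoly F v (A *v w) = \<mu> powi (- int (d - 1)) * dpoly F v w" for w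
    using dpoly_invariant[OF inv(1), of v w] dpoly_scale_point[OF F(1), of \<mu> v "A *v w"] v(2)
    by (simp add: power_int_minus field_simps)
  show "\<mu> powi (- int (d - 1)) \<in> eigenvalues A"
  proof (rule ccontr)
    assume no: "\<not> ?thesis"
    have "dpoly F v x = 0" for x
    proof -
      obtain y where "x = A *v y - \<mu> powi (- int (d - 1)) *s y"
        using matrix_bij_of_not_eigenvalue[OF no] by blast
      then have "A *v y = x + \<mu> powi (- int (d - 1)) *s y" by simp
      then have "dpoly F v (A *v y) = dpoly F v x + \<mu> powi (- int (d - 1)) * dpoly F v y"
        by (simp only: dpoly_add dpoly_scale)
      then show ?thesis using l[of y] by simp
    qed
    then show False using dpoly_nonzero[OF F(2) v(1)] by simp
  qed
qed

lemma finite_powi_eq_powi: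
  assumes "p \<noteq> q"
  shows "finite {z::complex. z \<noteq> 0 \<and> z powi p = z powi q}"
proof -
  have "{z::complex. z \<noteq> 0 \<and> z powi p = z powi q} = {z. z \<noteq> 0 \<and> z powi (p - q) = 1}"
    by (auto simp: power_int_diff)
  then show ?thesis using powi_roots(1)[of "p - q" 1] assms by simp
qed

lemma eigenvalues_Aut_form_finite:
  fixes F :: "'n::finite cpoly"
  assumes "d \<ge> 3" "form_of_degree d F" "smooth_form F"
  obtains L where "finite L" "\<And>A. A \<in> Aut_form F \<Longrightarrow> eigenvalues A \<subseteq> L"
proof -
  define e where "e = - int (d - 1)"
  define N where "N = CARD('n)"
  \<comment> \<open>By pigeonhole, the \<open>N + 1\<close> eigenvalues
    \<open>\<mu> powi (e ^ k)\<close> with \<open>k \<le> N\<close> cannot all differ.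
    \<open>L\<close> contains every number for which two of them coincide, and depends only on
    \<open>d\<close> and \<open>N\<close>.\<close>
  define L where "L = (\<Union>a\<in>{..N}. \<Union>b\<in>{..N} - {a}. {z::complex. z \<noteq> 0 \<and> z powi (e ^ a) = z powi (e ^ b)})"
  have "e ^ a \<noteq> e ^ b" if "a \<noteq> b" for a b
  proof
    assume "e ^ a = e ^ b"
    then have "\<bar>e\<bar> ^ a = \<bar>e\<bar> ^ b" by (metis power_abs)
    moreover have "\<bar>e\<bar> > 1" using assms(1) by (simp add: e_def)
    ultimately show False using that by (simp add: power_inject_exp)
  qed
  then have "finite L" by (auto simp: L_def intro!: finite_powi_eq_powi)
  moreover have "eigenvalues A \<subseteq> L" if A: "A \<in> Aut_form F" for A
  proof
    fix \<mu> assume \<mu>: "\<mu> \<in> eigenvalues A"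
    have seq: "\<mu> powi (e ^ k) \<in> eigenvalues A" for k
    proof (induction k)
      case 0 then show ?case using \<mu> by simp
    next
      case (Suc k)
      have "\<mu> powi (e ^ Suc k) = (\<mu> powi (e ^ k)) powi e"
        by (simp flip: power_int_mult add: mult.commute)
      then show ?case using eigenvalue_Aut_form(2)[OF assms(2,3) A Suc] by (simp add: e_def)
    qed
    have "\<not> inj_on (\<lambda>k. \<mu> powi (e ^ k)) {..N}"
    proof
      assume "inj_on (\<lambda>k. \<mu> powi (e ^ k)) {..N}"
      then have "card {..N} \<le> card (eigenvalues A)"
        by (rule card_inj_on_le) (use seq finite_eigenvalues in auto)
      then show False using finite_eigenvalues(2)[of A] by (simp add: N_def)
    qed
    then show "\<mu> \<in> L" using eigenvalue_Aut_form(1)[OF assms(2,3) A \<mu>]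
      by (auto simp: L_def inj_on_def)
  qed
  ultimately show ?thesis by (rule that)
qed

text \<open>The complex linear span of \<open>G\<close>, with scalar multiples written as
  \<open>mat c ** g\<close>. Since \<open>G\<close> will be closed under products, it is the algebra
  generated by \<open>G\<close>.\<close>

inductive_set alg_span :: "(complex ^ 'n ^ 'n) set \<Rightarrow> (complex ^ 'n ^ 'n) set"
  for G :: "(complex ^ 'n::finite ^ 'n) set" where
  zero: "0 \<in> alg_span G"
| step: "a \<in> alg_span G \<Longrightarrow> g \<in> G \<Longrightarrow> a + mat c ** g \<in> alg_span G"

lemma mat_scalar_commute: "g ** mat c = mat c ** (g :: complex ^ 'n::finite ^ 'n)"
  by (simp add: matrix_eq mat_scalar_mult vector_scalar_commute flip: matrix_vector_mul_assoc)

lemma mat_mult_mat: "mat c ** mat c' = (mat (c * c') :: complex ^ 'n::finite ^ 'n)"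
  by (simp add: matrix_eq mat_scalar_mult flip: matrix_vector_mul_assoc)

lemma matrix_mult_diff_rdistrib: "(A - B) ** C = A ** C - B ** (C :: complex ^ 'n::finite ^ 'n)"
  by (simp add: matrix_eq matrix_vector_mult_diff_rdistrib flip: matrix_vector_mul_assoc)

lemma matrix_mult_add_rdistrib: "(A + B) ** C = A ** C + B ** (C :: complex ^ 'n::finite ^ 'n)"
  by (simp add: matrix_eq matrix_vector_mult_add_rdistrib flip: matrix_vector_mul_assoc)

context
  fixes G :: "(complex ^ 'n::finite ^ 'n) set"
  assumes one: "mat 1 \<in> G" and mult: "\<And>g h. g \<in> G \<Longrightarrow> h \<in> G \<Longrightarrow> g ** h \<in> G"
begin

lemma alg_span_base: "g \<in> G \<Longrightarrow> g \<in> alg_span G"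
  using alg_span.step[OF alg_span.zero, of g G 1] by simp

lemma alg_span_add: "b \<in> alg_span G \<Longrightarrow> a \<in> alg_span G \<Longrightarrow> a + b \<in> alg_span G"
  by (induction rule: alg_span.induct) (auto simp: add.assoc[symmetric] intro: alg_span.step)

lemma alg_span_scale: "a \<in> alg_span G \<Longrightarrow> mat c ** a \<in> alg_span G"
proof (induction rule: alg_span.induct)
  case (step a g c')
  then show ?case
    by (auto simp: matrix_add_ldistrib matrix_mul_assoc mat_mult_mat intro: alg_span.step)
qed (simp add: alg_span.zero)

lemma alg_span_mult_left: "a \<in> alg_span G \<Longrightarrow> g \<in> G \<Longrightarrow> g ** a \<in> alg_span G"
proof (induction rule: alg_span.induct)
  case (step a h c)
  have "g ** (a + mat c ** h) = g ** a + mat c ** (g ** h)"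
    by (simp add: matrix_add_ldistrib matrix_mul_assoc mat_scalar_commute)
  then show ?case using step mult by (auto intro: alg_span.step)
qed (simp add: alg_span.zero)

lemma alg_span_mult: "b \<in> alg_span G \<Longrightarrow> a \<in> alg_span G \<Longrightarrow> b ** a \<in> alg_span G"
proof (induction rule: alg_span.induct)
  case (step b g c)
  have "(b + mat c ** g) ** a = b ** a + mat c ** (g ** a)"
    by (simp add: matrix_mult_add_rdistrib matrix_mul_assoc)
  then show ?case using step by (auto intro!: alg_span_add alg_span_scale alg_span_mult_left)
qed (simp add: alg_span.zero)

lemma alg_span_diff: "a \<in> alg_span G \<Longrightarrow> b \<in> alg_span G \<Longrightarrow> a - b \<in> alg_span G"
proof -
  assume "a \<in> alg_span G" "b \<in> alg_span G"
  then have "a + mat (- 1) ** b \<in> alg_span G" by (intro alg_span_add alg_span_scale)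
  moreover have "a + mat (- 1) ** b = a - b"
    by (simp add: matrix_eq matrix_vector_mult_add_rdistrib matrix_vector_mult_diff_rdistrib mat_scalar_mult
        flip: matrix_vector_mul_assoc)
  ultimately show ?thesis by simp
qed

lemma alg_span_matpow: "a \<in> alg_span G \<Longrightarrow> matpow a k \<in> alg_span G"
  by (induction k) (auto intro: alg_span_mult alg_span_base one)

end

lemma alg_span_stable: "a \<in> alg_span G \<Longrightarrow> stable_subspace G V \<Longrightarrow> v \<in> V \<Longrightarrow> a *v v \<in> V"
proof (induction rule: alg_span.induct)
  case zero
  then show ?case by (simp add: stable_subspace_def vec.subspace_0)
next
  case (step a g c)
  then have "vec.subspace V" "g *v v \<in> V" by (auto simp: stable_subspace_def)
  then show ?case using step
    by (auto simp: matrix_vector_mult_add_rdistrib mat_scalar_mult simp flip: matrix_vector_mul_assoc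
        intro!: vec.subspace_add vec.subspace_scale)
qed

section \<open>The trace form and Burnside's finiteness argument\<close>

lemma trace_mat_mult: "trace (mat c ** (A :: complex ^ 'n::finite ^ 'n)) = c * trace A"
proof -
  have "mat c $ i $ k * A $ k $ i = (if k = i then c * A $ k $ i else 0)" for i k
    by (simp add: Finite_Cartesian_Product.mat_def)
  then show ?thesis by (simp add: trace_def matrix_matrix_mult_def sum_distrib_left)
qed

lemma trace_alg_span_eq_0:
  assumes "\<And>g. g \<in> G \<Longrightarrow> trace (x ** g) = 0"
  shows "a \<in> alg_span G \<Longrightarrow> trace (x ** a) = 0"
proof (induction rule: alg_span.induct)
  case (step a g c)
  have "x ** (a + mat c ** g) = x ** a + mat c ** (x ** g)"
    by (simp add: matrix_add_ldistrib matrix_mul_assoc mat_scalar_commute)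
  then show ?case using step assms by (simp add: trace_add trace_mat_mult)
qed (simp add: trace_def)

text \<open>The map sending \<open>g\<close> to \<open>trace (x ** g)\<close> is linear, so it
  suffices to test it on a basis, chosen inside \<open>G\<close>, of the span of \<open>G\<close>.
  The same finite \<open>B\<close> serves all \<open>x\<close>.\<close>

lemma finite_trace_test_set:
  fixes G :: "(complex ^ 'n::finite ^ 'n) set"
  obtains B where "finite B" "B \<subseteq> G"
    "\<And>x g. (\<And>b. b \<in> B \<Longrightarrow> trace (x ** b) = 0) \<Longrightarrow> g \<in> G \<Longrightarrow> trace (x ** g) = 0"
proof -
  \<comment> \<open>Matrices become vectors indexed by pairs, to which the theory of complex spans
    and bases applies.\<close>
  define flat where "flat g = (\<chi> p. g $ fst p $ snd p)" for g :: "complex ^ 'n ^ 'n"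
  obtain B' where B': "B' \<subseteq> flat ` G" "vec.independent B'" "flat ` G \<subseteq> vec.span B'"
    using vec.maximal_independent_subset[of "flat ` G"] by metis
  have "finite B'" using B'(2) vec.finiteI_independent by blast
  then obtain B where B: "finite B" "B \<subseteq> G" "B' = flat ` B"
    using B'(1) by (metis finite_subset_image)
  show ?thesis
  proof (rule that[OF B(1,2)])
    fix x g assume zero: "\<And>b. b \<in> B \<Longrightarrow> trace (x ** b) = 0" and g: "g \<in> G"
    define l where "l z = (\<Sum>i\<in>UNIV. \<Sum>j\<in>UNIV. x $ i $ j * z $ (j, i))" for z :: "complex ^ ('n \<times> 'n)"
    have l: "l (flat h) = trace (x ** h)" for h
      by (simp add: l_def flat_def trace_def matrix_matrix_mult_def)
    have "vec.subspace {z. l z = 0}"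
      by (rule vec.subspaceI)
        (auto simp: l_def distrib_left sum.distrib sum_distrib_left[symmetric] mult.left_commute)
    then have "vec.span B' \<subseteq> {z. l z = 0}"
      by (intro vec.span_minimal) (use zero l B in auto)
    then show "trace (x ** g) = 0" using g B'(3) unfolding l[symmetric] by blast
  qed
qed

text \<open>An element \<open>g\<close> is determined by the numbers \<open>trace (g ** b)\<close>
  for \<open>b\<close> in the finite test set \<open>B\<close>, and each of them lies in the finite
  set of traces of \<open>G\<close>.\<close>

lemma finite_of_finite_traces:
  fixes G :: "(complex ^ 'n::finite ^ 'n) set" and m :: nat
  assumes one: "mat 1 \<in> G" and mult: "\<And>g h. g \<in> G \<Longrightarrow> h \<in> G \<Longrightarrow> g ** h \<in> G"
    and tr: "finite (trace ` G)"
    and V: "is_direct_sum {..<m} V UNIV" "\<And>i. i < m \<Longrightarrow> acts_irreducibly G (V i)"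
  shows "finite G"
proof -
  obtain B where B: "finite B" "B \<subseteq> G"
    "\<And>x g. (\<And>b. b \<in> B \<Longrightarrow> trace (x ** b) = 0) \<Longrightarrow> g \<in> G \<Longrightarrow> trace (x ** g) = 0"
    using finite_trace_test_set[of G] by blast
  note span = alg_span_mult[OF one mult] alg_span_base[OF one mult] alg_span_matpow[OF one mult]
    alg_span_diff[OF one mult] alg_span_add[OF one mult] alg_span_scale[OF one mult]
    alg_span_mult_left[OF one mult]
  have "inj_on (\<lambda>g. restrict (\<lambda>b. trace (g ** b)) B) G"
  proof (rule inj_onI, rule ccontr)
    fix g h assume g: "g \<in> G" and h: "h \<in> G" and ne: "g \<noteq> h"
      and eq: "restrict (\<lambda>b. trace (g ** b)) B = restrict (\<lambda>b. trace (h ** b)) B"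
    \<comment> \<open>\<open>x\<close> lies in the radical of the trace form on the span of \<open>G\<close>. If \<open>x \<noteq> 0\<close>, irreducibility yields
      \<open>a x w = w\<close> for some \<open>a\<close> in the span and \<open>w \<noteq> 0\<close>, although all powers of \<open>a x\<close> have trace \<open>0\<close>.\<close>
    define x where "x = g - h"
    have "trace (g ** b) = trace (h ** b)" if "b \<in> B" for b using fun_cong[OF eq, of b] that by simp
    then have "trace (x ** b) = 0" if "b \<in> B" for b
      using that by (simp add: x_def matrix_mult_diff_rdistrib trace_sub)
    then have tr0: "trace (x ** a) = 0" if "a \<in> alg_span G" for a
      using trace_alg_span_eq_0[OF B(3)] that by blast
    have x: "x \<in> alg_span G" using g h unfolding x_def by (intro span(4) span(2))
    obtain v where v: "x *v v \<noteq> 0" using ne by (auto simp: x_def matrix_eq matrix_vector_mult_diff_rdistrib)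
    have "v \<in> (\<lambda>u. \<Sum>i\<in>{..<m}. u i) ` Pi\<^sub>E {..<m} V"
      using V(1) by (simp add: is_direct_sum_def bij_betw_def)
    then obtain u where u: "u \<in> Pi\<^sub>E {..<m} V" "v = (\<Sum>i<m. u i)" by blast
    have "x *v v = (\<Sum>i<m. x *v u i)"
      unfolding u(2) by (induction m) (simp_all add: matrix_vector_right_distrib)
    then obtain i where i: "i < m" "x *v u i \<noteq> 0" using v by (metis (mono_tags, lifting) lessThan_iff sum.neutral)
    have irr: "acts_irreducibly G (V i)" and ui: "u i \<in> V i" using V(2) u(1) i by auto
    \<comment> \<open>The cyclic submodule generated by the nonzero vector \<open>x *v u i\<close>.
      Irreducibility makes it all of \<open>V i\<close>, so it contains \<open>u i\<close>, which
      provides the \<open>a\<close> with \<open>a x (u i) = u i\<close>.\<close>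
    define U where "U = (\<lambda>a. a *v (x *v u i)) ` alg_span G"
    have st: "stable_subspace G (V i)" using irr by (simp add: acts_irreducibly_def)
    have "U \<subseteq> V i" using alg_span_stable[OF _ st] x ui by (auto simp: U_def)
    moreover have "stable_subspace G U"
      unfolding stable_subspace_def
    proof (intro conjI ballI subsetI)
      show "vec.subspace U"
      proof (rule vec.subspaceI)
        show "0 \<in> U" unfolding U_def by (rule image_eqI[OF _ alg_span.zero]) simp
        show "p + q \<in> U" if "p \<in> U" "q \<in> U" for p q
          using that span(5) by (auto simp: U_def simp flip: matrix_vector_mult_add_rdistrib)
        show "c *s p \<in> U" if "p \<in> U" for c p
        proof -
          obtain a where "a \<in> alg_span G" "p = a *v (x *v u i)" using \<open>p \<in> U\<close> by (auto simp: U_def)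
          then have "mat c ** a \<in> alg_span G" "c *s p = (mat c ** a) *v (x *v u i)"
            using span(6) by (auto simp: mat_scalar_mult simp flip: matrix_vector_mul_assoc)
          then show ?thesis by (auto simp: U_def)
        qed
      qed
      show "y \<in> U" if k: "k \<in> G" and y: "y \<in> (*v) k ` U" for k y
      proof -
        obtain a where "a \<in> alg_span G" "y = k *v (a *v (x *v u i))" using y by (auto simp: U_def)
        then have "k ** a \<in> alg_span G" "y = (k ** a) *v (x *v u i)"
          using span(7) k by (simp_all flip: matrix_vector_mul_assoc)
        then show ?thesis by (auto simp: U_def)
      qed
    qed
    ultimately have "U = {0} \<or> U = V i" using irr by (auto simp: acts_irreducibly_def)
    moreover have "x *v u i \<in> U" unfolding U_def
      by (rule image_eqI[of _ _ "mat 1"]) (use span(2)[OF _ _ one] in auto)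
    ultimately have "u i \<in> U" using i ui by auto
    then obtain a where a: "a \<in> alg_span G" "u i = a *v (x *v u i)" by (auto simp: U_def)
    \<comment> \<open>Moving the leading \<open>a\<close> to the end turns a positive power of
      \<open>a x\<close> into \<open>x\<close> times an element of the span, which has trace
      0.\<close>
    have "trace (matpow (a ** x) k) = 0" if "k > 0" for k
    proof -
      obtain k' where k': "k = Suc k'" using \<open>k > 0\<close> by (cases k) auto
      have "trace (matpow (a ** x) k) = trace (a ** (x ** matpow (a ** x) k'))"
        by (simp add: k' matrix_mul_assoc)
      also have "\<dots> = trace (x ** (matpow (a ** x) k' ** a))"
        by (subst trace_mul_sym) (simp add: matrix_mul_assoc)
      also have "\<dots> = 0" by (intro tr0 span(1) span(3) a x)
      finally show ?thesis .
    qed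
    then have "1 \<notin> eigenvalues (a ** x)" by (rule trace_matpow_zero_imp)
    moreover have "u i \<noteq> 0" using i by auto
    ultimately show False using a(2) by (auto simp: eigenvalues_def simp flip: matrix_vector_mul_assoc)
  qed
  moreover have "(\<lambda>g. restrict (\<lambda>b. trace (g ** b)) B) ` G \<subseteq> B \<rightarrow>\<^sub>E trace ` G"
    using B(2) mult by auto
  moreover have "finite (B \<rightarrow>\<^sub>E trace ` G)" using B(1) tr by (intro finite_PiE) auto
  ultimately show ?thesis by (rule inj_on_finite)
qed

section \<open>The bound\<close>

text \<open>An element of \<open>T\<close> is determined by its scalars \<open>t g a\<close>,
  because the \<open>W a\<close> span. These scalars solve a monomial system in which every exponent
  is \<open>- (d - 1)\<close>.\<close>

lemma card_scalar_automorphisms: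
  fixes F :: "'n::finite cpoly" and W :: "'a \<Rightarrow> (complex ^ 'n) set"
  assumes d: "d \<ge> 3" and F: "form_of_degree d F" "smooth_form F"
    and T: "T \<subseteq> Aut_form F" and S: "finite S"
    and W: "\<And>a. a \<in> S \<Longrightarrow> vec.subspace (W a)" "\<And>a. a \<in> S \<Longrightarrow> W a \<noteq> {0}"
    and span: "\<And>v. \<exists>u. (\<forall>a\<in>S. u a \<in> W a) \<and> v = (\<Sum>a\<in>S. u a)"
    and scal: "\<And>g a. g \<in> T \<Longrightarrow> a \<in> S \<Longrightarrow> \<exists>c. \<forall>w\<in>W a. g *v w = c *s w"
  shows "card T \<le> d ^ card S"
proof -
  have "\<exists>v. v \<in> W a \<and> v \<noteq> 0" if "a \<in> S" for a
    using W(1)[OF that] W(2)[OF that] vec.subspace_0 by blast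
  then obtain p where p: "\<And>a. a \<in> S \<Longrightarrow> p a \<in> W a \<and> p a \<noteq> 0" by metis
  \<comment> \<open>By linearity, a functional that vanishes on every \<open>W b\<close> vanishes on
    the whole space, whereas D F(p a) is nonzero.\<close>
  have "\<exists>b. b \<in> S \<and> (\<exists>w\<in>W b. dpoly F (p a) w \<noteq> 0)" if a: "a \<in> S" for a
  proof (rule ccontr)
    assume no: "\<not> ?thesis"
    obtain v where v: "dpoly F (p a) v \<noteq> 0" using dpoly_nonzero[OF F(2)] p[OF a] by blast
    obtain u where u: "\<forall>b\<in>S. u b \<in> W b" "v = (\<Sum>b\<in>S. u b)" using span by blast
    have "dpoly F (p a) v = (\<Sum>b\<in>S. dpoly F (p a) (u b))"
      unfolding u(2) by (induction S rule: infinite_finite_induct) (simp_all add: dpoly_add, simp_all add: dpoly_def)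
    also have "\<dots> = 0" using no u(1) by (intro sum.neutral) blast
    finally show False using v by simp
  qed
  then obtain \<phi> where \<phi>: "\<And>a. a \<in> S \<Longrightarrow> \<phi> a \<in> S \<and> (\<exists>w\<in>W (\<phi> a). dpoly F (p a) w \<noteq> 0)" by metis
  obtain t where t: "\<And>g a w. g \<in> T \<Longrightarrow> a \<in> S \<Longrightarrow> w \<in> W a \<Longrightarrow> g *v w = t g a *s w"
    using scal by metis
  let ?X = "monomial_sols S \<phi> (\<lambda>_. - int (d - 1))"
  have "restrict (t g) S \<in> ?X" if g: "g \<in> T" for g
  proof -
    have "t g a \<noteq> 0 \<and> t g (\<phi> a) = t g a powi (- int (d - 1))" if a: "a \<in> S" for a
    proof -
      obtain w where w: "w \<in> W (\<phi> a)" "dpoly F (p a) w \<noteq> 0" using \<phi>[OF a] by blast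
      have "lin_subst g F = F" using g T by (auto simp: Aut_form_def)
      from dpoly_invariant[OF this, of "p a" w]
      have "t g a ^ (d - 1) * (t g (\<phi> a) * dpoly F (p a) w) = dpoly F (p a) w"
        using t[OF g a] t[OF g _ w(1)] p[OF a] \<phi>[OF a] by (simp add: dpoly_scale_point[OF F(1)] dpoly_scale mult.commute)
      then have eq: "t g a ^ (d - 1) * t g (\<phi> a) = 1" using w(2) by (simp add: mult.commute)
      then have "t g a \<noteq> 0" using d by (auto simp: zero_power)
      then show ?thesis using eq by (simp add: power_int_minus field_simps)
    qed
    then show ?thesis using \<phi> by (auto simp: monomial_sols_def)
  qed
  then have sub: "(\<lambda>g. restrict (t g) S) ` T \<subseteq> ?X" by blast
  have inj: "inj_on (\<lambda>g. restrict (t g) S) T"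
  proof (rule inj_onI)
    fix g h assume g: "g \<in> T" and h: "h \<in> T" and eq: "restrict (t g) S = restrict (t h) S"
    have agree: "g *v w = h *v w" if "a \<in> S" "w \<in> W a" for a w
      using t[OF g that] t[OF h that] fun_cong[OF eq, of a] that(1) by simp
    have "g *v v = h *v v" for v
    proof -
      obtain u where u: "\<forall>a\<in>S. u a \<in> W a" "v = (\<Sum>a\<in>S. u a)" using span by blast
      have "k *v v = (\<Sum>a\<in>S. k *v u a)" for k :: "complex ^ 'n ^ 'n"
        unfolding u(2) by (induction S rule: infinite_finite_induct) (simp_all add: matrix_vector_right_distrib)
      moreover have "(\<Sum>a\<in>S. g *v u a) = (\<Sum>a\<in>S. h *v u a)"
        using u(1) agree by (intro sum.cong) auto
      ultimately show ?thesis by simp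
    qed
    then show "g = h" by (simp add: matrix_eq)
  qed
  have X: "finite ?X" "card ?X \<le> (\<Prod>a\<in>S. nat \<bar>- int (d - 1)\<bar> + 1)"
    using monomial_sols_card[OF S, of \<phi> "\<lambda>_. - int (d - 1)"] \<phi> d by auto
  have "card T \<le> card ?X" using card_inj_on_le[OF inj sub X(1)] .
  also note X(2)
  \<comment> \<open>Each unknown thus contributes a factor of exactly \<open>d\<close>.\<close>
  also have "nat \<bar>- int (d - 1)\<bar> + 1 = d" using d by arith
  finally show ?thesis by simp
qed

text \<open>The restriction of \<open>h\<close> lies in its own coset of the scalars, as the
  multiple by 1. If this is also the coset of \<open>g\<close>, then \<open>h\<close> is a scalar
  multiple of \<open>g\<close> on \<open>W\<close>.\<close>

lemma to_PGL_eq_imp_scalar: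
  assumes W: "vec.subspace W"
    and g: "invertible g" "(*v) g ` W = W" and h: "invertible h" "(*v) h ` W = W"
    and eq: "to_PGL W g = to_PGL W h"
  shows "\<exists>c. \<forall>w\<in>W. h *v w = c *s (g *v w)"
proof -
  have Bij: "restrict ((*v) k) W \<in> Bij W" if "invertible k" "(*v) k ` W = W" for k
  proof -
    have "inj_on ((*v) k) W" using inj_matrix_vector_mult[OF that(1)] inj_on_subset by blast
    then show ?thesis using that(2) by (auto simp: Bij_def bij_betw_def)
  qed
  have sBij: "restrict (\<lambda>v. c *s v) W \<in> Bij W" if "c \<noteq> 0" for c
  proof -
    have "bij_betw (\<lambda>v. c *s v) W W"
      by (rule bij_betwI[where g = "\<lambda>v. inverse c *s v"])
        (use W that in \<open>auto simp: vec.subspace_scale vec.scale_scale\<close>)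
    then show ?thesis by (simp add: Bij_def)
  qed
  have "restrict ((*v) h) W = restrict (\<lambda>v. 1 *s v) W \<otimes>\<^bsub>GL_on W\<^esub> restrict ((*v) h) W"
    using Bij[OF h] sBij[of 1] W h(2)
    by (auto simp: GL_on_def BijGroup_def compose_def fun_eq_iff)
  moreover have "restrict (\<lambda>v. 1 *s v) W \<in> scalars_on W"
    unfolding scalars_on_def by (intro CollectI exI[of _ 1] conjI refl) simp
  ultimately have "restrict ((*v) h) W \<in> to_PGL W h"
    unfolding to_PGL_def r_coset_def by blast
  then have "restrict ((*v) h) W \<in> to_PGL W g" using eq by simp
  then obtain c where c: "c \<noteq> 0"
    "restrict ((*v) h) W = restrict (\<lambda>v. c *s v) W \<otimes>\<^bsub>GL_on W\<^esub> restrict ((*v) g) W"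
    unfolding to_PGL_def r_coset_def scalars_on_def by auto
  have "restrict ((*v) h) W = compose W (restrict (\<lambda>v. c *s v) W) (restrict ((*v) g) W)"
    using c(2) Bij[OF g] sBij[OF c(1)] by (simp add: GL_on_def BijGroup_def)
  then have "h *v w = c *s (g *v w)" if "w \<in> W" for w
    using that g(2) by (auto simp: compose_def fun_eq_iff split: if_splits dest!: spec[of _ w])
  then show ?thesis by blast
qed

section \<open>Direct sums and counting modulo a kernel\<close>

lemma is_direct_sum_inj:
  assumes sum: "is_direct_sum I U X" and ij: "i \<in> I" "j \<in> I" and eq: "U i = U j" "U i \<noteq> {0}"
  shows "i = j"
proof (rule ccontr)
  assume "i \<noteq> j"
  have I: "finite I" and sub: "\<And>l. l \<in> I \<Longrightarrow> vec.subspace (U l)"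
    and inj: "inj_on (\<lambda>u. \<Sum>l\<in>I. u l) (Pi\<^sub>E I U)"
    using sum by (auto simp: is_direct_sum_def bij_betw_def)
  obtain w where w: "w \<in> U i" "w \<noteq> 0" using eq(2) sub[OF ij(1)] vec.subspace_0 by blast
  \<comment> \<open>The tuple \<open>u l\<close> has \<open>w\<close> in place \<open>l\<close> and
    0 elsewhere. Both \<open>u i\<close> and \<open>u j\<close> sum to \<open>w\<close>, against the
    uniqueness of decompositions.\<close>
  define u where "u l = restrict (\<lambda>l'. if l' = l then w else 0) I" for l
  have "u l \<in> Pi\<^sub>E I U" if "l = i \<or> l = j" for l
    using that w(1) eq(1) vec.subspace_0[OF sub] by (auto simp: u_def)
  moreover have "(\<Sum>l'\<in>I. u l l') = w" if "l = i \<or> l = j" for l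
  proof -
    have "(\<Sum>l'\<in>I. u l l') = (\<Sum>l'\<in>I. if l' = l then w else 0)"
      by (rule sum.cong) (auto simp: u_def)
    then show ?thesis using that ij I by auto
  qed
  ultimately have "u i = u j" using inj_onD[OF inj, of "u i" "u j"] by simp
  then have "u i i = u j i" by simp
  then show False using \<open>i \<noteq> j\<close> ij w(2) by (simp add: u_def)
qed

lemma is_direct_sum_decompose:
  assumes "is_direct_sum I U X" "x \<in> X"
  shows "\<exists>u. (\<forall>i\<in>I. u i \<in> U i) \<and> x = (\<Sum>i\<in>I. u i)"
proof -
  have "x \<in> (\<lambda>u. \<Sum>i\<in>I. u i) ` Pi\<^sub>E I U" using assms by (simp add: is_direct_sum_def bij_betw_def)
  then show ?thesis by (auto simp: PiE_iff)
qed

lemma subgroup_GL_inverse: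
  assumes "subgroup G GL" "g \<in> G"
  obtains g' where "g' \<in> G" "g' ** g = mat 1" "g ** g' = mat 1"
proof
  interpret group "GL :: (complex ^ 'n ^ 'n) monoid" by (rule group_GL)
  have g: "g \<in> carrier GL" using assms subgroup.subset by blast
  show "inv\<^bsub>GL\<^esub> g \<in> G" using assms by (rule subgroup.m_inv_closed)
  show "(inv\<^bsub>GL\<^esub> g) ** g = mat 1" "g ** (inv\<^bsub>GL\<^esub> g) = mat 1"
    using l_inv[OF g] r_inv[OF g] by (simp_all add: GL_def)
qed

text \<open>Plays the part of "order at most image times kernel" without making \<open>f\<close> a
  homomorphism: left multiplication by an inverse of \<open>g\<close> embeds the fibre of
  \<open>f\<close> through \<open>g\<close> into \<open>Y\<close>.\<close>

lemma card_le_card_mult_kernel: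
  assumes G: "subgroup G GL" and XY: "X \<subseteq> G" "finite X" "finite Y" "f ` X \<subseteq> B" "finite B"
    and ker: "\<And>g h g'. g \<in> X \<Longrightarrow> h \<in> X \<Longrightarrow> f h = f g \<Longrightarrow> g' \<in> G \<Longrightarrow> g' ** g = mat 1 \<Longrightarrow> g' ** h \<in> Y"
  shows "card X \<le> card B * card Y"
proof (rule card_le_card_mult_fibre[OF XY(2,4,5)])
  fix g assume g: "g \<in> X"
  then obtain g' where g': "g' \<in> G" "g' ** g = mat 1" "g ** g' = mat 1"
    using subgroup_GL_inverse[OF G] XY(1) by blast
  have "inj_on ((**) g') {h \<in> X. f h = f g}"
  proof (rule inj_onI)
    fix h k assume "g' ** h = g' ** k"
    then have "g ** g' ** h = g ** g' ** k" by (simp flip: matrix_mul_assoc)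
    then show "h = k" using g' by simp
  qed
  moreover have "(**) g' ` {h \<in> X. f h = f g} \<subseteq> Y" using ker g g' by blast
  ultimately show "card {h \<in> X. f h = f g} \<le> card Y" using XY(3) by (rule card_inj_on_le)
qed

lemma image_matrix_cancel:
  assumes "g' ** g = mat 1" "(*v) h ` U = (*v) g ` U"
  shows "(*v) (g' ** h) ` U = U"
proof -
  have "(*v) (g' ** h) ` U = (*v) g' ` (*v) h ` U"
    by (simp add: image_image matrix_vector_mul_assoc)
  also have "\<dots> = (*v) (g' ** g) ` U"
    by (simp add: assms(2) image_image matrix_vector_mul_assoc)
  finally show ?thesis using assms(1) by simp
qed

lemma image_matrix_inj:
  fixes g :: "complex ^ 'n::finite ^ 'n"
  assumes "invertible g" "(*v) g ` U = (*v) g ` U'"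
  shows "U = U'"
  using assms(2) inj_matrix_vector_mult[OF assms(1)] by (simp add: inj_image_eq_iff)

theorem lemma3p7:
  fixes F :: "'n::finite cpoly" and d :: nat
    and G :: "(complex ^ 'n ^ 'n) set"
    and m :: nat and k :: "nat \<Rightarrow> nat"
    and V :: "nat \<Rightarrow> (complex ^ 'n) set" and W :: "nat \<Rightarrow> nat \<Rightarrow> (complex ^ 'n) set"
  assumes "d \<ge> 3"
    and "form_of_degree d F"
    and "smooth_form F"
    and "subgroup G GL"
    and "G \<subseteq> Aut_form F"
    and "decomposition_data G m V k W"
  shows "finite G \<and> card G \<le> canonical_bound d G m k W"
proof -
  note data = \<open>decomposition_data G m V k W\<close>[unfolded decomposition_data_def]
  have V: "is_direct_sum {..<m} V UNIV" "\<And>i. i < m \<Longrightarrow> acts_irreducibly G (V i)"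
    and W: "\<And>i. i < m \<Longrightarrow> is_direct_sum {..<k i} (W i) (V i)"
      "\<And>g i j. g \<in> G \<Longrightarrow> i < m \<Longrightarrow> j < k i \<Longrightarrow> \<exists>j'<k i. (*v) g ` W i j = W i j'"
      "\<And>i j. i < m \<Longrightarrow> j < k i \<Longrightarrow> acts_primitively (setwise_stab G (W i j)) (W i j)"
    using data by blast+
  have Wsub: "vec.subspace (W i j)" "W i j \<noteq> {0}" if "i < m" "j < k i" for i j
    using W(3)[OF that] by (auto simp: acts_primitively_def acts_irreducibly_def stable_subspace_def)
  have one: "mat 1 \<in> G" using subgroup.one_closed[OF assms(4)] by (simp add: GL_def)
  have mult: "g ** h \<in> G" if "g \<in> G" "h \<in> G" for g h
    using subgroup.m_closed[OF assms(4) that] by (simp add: GL_def)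
  have inv: "invertible g" if "g \<in> G" for g
    using subgroup.subset[OF assms(4)] that by (auto simp: GL_def)
  obtain L where L: "finite L" "\<And>A. A \<in> Aut_form F \<Longrightarrow> eigenvalues A \<subseteq> L"
    using eigenvalues_Aut_form_finite[OF assms(1-3)] by blast
  have "finite (trace ` G)" using finite_traces[OF L(1), of G] L(2) assms(5) by blast
  then have fin: "finite G" using finite_of_finite_traces[OF one mult _ V] by blast
  define S where "S = (SIGMA i:{..<m}. {..<k i})"
  have S: "finite S" "card S = (\<Sum>i<m. k i)" by (auto simp: S_def)
  \<comment> \<open>\<open>K\<close> is the kernel of the permutation action on the
    \<open>W i j\<close>, and \<open>T\<close> consists of the elements acting on each
    \<open>W i j\<close> by a scalar. Passing from \<open>G\<close> to \<open>K\<close>, from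
    \<open>K\<close> to \<open>T\<close>, and counting \<open>T\<close> yields the three factors of
    the bound.\<close>
  define K where "K = {g \<in> G. \<forall>i<m. \<forall>j<k i. (*v) g ` W i j = W i j}"
  define T where "T = {g \<in> G. \<forall>i<m. \<forall>j<k i. \<exists>c. \<forall>w\<in>W i j. g *v w = c *s w}"
  have sub: "K \<subseteq> G" "T \<subseteq> G" by (auto simp: K_def T_def)
  then have finKT: "finite K" "finite T" using fin finite_subset by blast+

  have "card G \<le> card (Pi\<^sub>E {..<m} (\<lambda>i. {\<pi>. \<pi> permutes {..<k i}})) * card K"
  proof (rule card_le_card_mult_kernel[OF assms(4) order_refl fin finKT(1)])
    \<comment> \<open>The index of the subspace to which \<open>g\<close> moves
      \<open>W i j\<close>. Outside the block it is the identity, as \<open>permutes\<close>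
      demands.\<close>
    define \<sigma> where "\<sigma> g i j = (if j < k i then SOME j'. j' < k i \<and> (*v) g ` W i j = W i j' else j)" for g i j
    have \<sigma>: "\<sigma> g i j < k i" "(*v) g ` W i j = W i (\<sigma> g i j)" if "g \<in> G" "i < m" "j < k i" for g i j
      using someI_ex[OF W(2)[OF that]] that(3) by (auto simp: \<sigma>_def)
    \<comment> \<open>Nonzero summands of a direct sum are distinct and \<open>g\<close> is
      injective, so equal images force equal indices.\<close>
    have perm: "\<sigma> g i permutes {..<k i}" if g: "g \<in> G" and i: "i < m" for g i
    proof (rule bij_imp_permutes)
      have "inj_on (\<sigma> g i) {..<k i}"
      proof (rule inj_onI)
        fix j l assume jl: "j \<in> {..<k i}" "l \<in> {..<k i}" and eq: "\<sigma> g i j = \<sigma> g i l"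
        then have "(*v) g ` W i j = (*v) g ` W i l" using \<sigma>(2)[OF g i] by simp
        then have "W i j = W i l" by (rule image_matrix_inj[OF inv[OF g]])
        then show "j = l" using is_direct_sum_inj[OF W(1)[OF i] jl] Wsub(2)[OF i] jl by simp
      qed
      moreover have "\<sigma> g i ` {..<k i} \<subseteq> {..<k i}" using \<sigma>(1)[OF g i] by auto
      ultimately show "bij_betw (\<sigma> g i) {..<k i} {..<k i}"
        by (simp add: bij_betw_def endo_inj_surj)
    qed (simp add: \<sigma>_def)
    show "(\<lambda>g. restrict (\<sigma> g) {..<m}) ` G \<subseteq> Pi\<^sub>E {..<m} (\<lambda>i. {\<pi>. \<pi> permutes {..<k i}})"
      using perm by auto
    show "finite (Pi\<^sub>E {..<m} (\<lambda>i. {\<pi>. \<pi> permutes {..<k i}}))"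
      by (intro finite_PiE) (auto intro: finite_permutations)
    show "g' ** h \<in> K" if g: "g \<in> G" "h \<in> G" and eq: "restrict (\<sigma> h) {..<m} = restrict (\<sigma> g) {..<m}"
      and g': "g' \<in> G" "g' ** g = mat 1" for g h g'
    proof -
      have "(*v) (g' ** h) ` W i j = W i j" if "i < m" "j < k i" for i j
        using image_matrix_cancel[OF g'(2)] \<sigma>(2)[OF g(1) that] \<sigma>(2)[OF g(2) that] fun_cong[OF eq, of i] that
        by simp
      then show ?thesis using mult g g' by (simp add: K_def)
    qed
  qed
  also have "card (Pi\<^sub>E {..<m} (\<lambda>i. {\<pi>. \<pi> permutes {..<k i}})) = (\<Prod>i<m. fact (k i))"
    by (simp add: card_PiE card_permutations[OF refl])
  finally have G: "card G \<le> (\<Prod>i<m. fact (k i)) * card K" .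

  let ?H = "\<lambda>(i, j). primitive_constituent G (W i j)"
  have "card K \<le> card (Pi\<^sub>E S ?H) * card T"
  proof (rule card_le_card_mult_kernel[OF assms(4) sub(1) finKT])
    show "(\<lambda>g. \<lambda>(i, j)\<in>S. to_PGL (W i j) g) ` K \<subseteq> Pi\<^sub>E S ?H"
      by (rule image_subsetI, simp only: restrict_PiE_iff)
        (auto simp: K_def S_def primitive_constituent_def setwise_stab_def)
    have "finite (primitive_constituent G (W i j))" for i j
      using fin by (auto simp: primitive_constituent_def setwise_stab_def)
    then show "finite (Pi\<^sub>E S ?H)" using S(1) by (intro finite_PiE) auto
    show "g' ** h \<in> T" if g: "g \<in> K" "h \<in> K"
      and eq: "(\<lambda>(i, j)\<in>S. to_PGL (W i j) h) = (\<lambda>(i, j)\<in>S. to_PGL (W i j) g)"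
      and g': "g' \<in> G" "g' ** g = mat 1" for g h g'
    proof -
      have "\<exists>c. \<forall>w\<in>W i j. (g' ** h) *v w = c *s w" if ij: "i < m" "j < k i" for i j
      proof -
        have "to_PGL (W i j) g = to_PGL (W i j) h"
          using fun_cong[OF eq, of "(i, j)"] ij by (simp add: S_def)
        then obtain c where c: "\<forall>w\<in>W i j. h *v w = c *s (g *v w)"
          using to_PGL_eq_imp_scalar[OF Wsub(1)[OF ij], of g h] g ij inv by (auto simp: K_def)
        have "(g' ** h) *v w = c *s w" if "w \<in> W i j" for w
        proof -
          have "(g' ** h) *v w = g' *v (c *s (g *v w))"
            using c that by (simp flip: matrix_vector_mul_assoc)
          also have "\<dots> = c *s ((g' ** g) *v w)"
            by (simp add: vector_scalar_commute matrix_vector_mul_assoc)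
          finally show ?thesis using g'(2) by simp
        qed
        then show ?thesis by blast
      qed
      then show ?thesis using mult g g' by (simp add: T_def K_def)
    qed
  qed
  also have "card (Pi\<^sub>E S ?H) = (\<Prod>i<m. \<Prod>j<k i. card (primitive_constituent G (W i j)))"
    using S(1) by (simp add: card_PiE S_def prod.Sigma case_prod_unfold)
  finally have K: "card K \<le> (\<Prod>i<m. \<Prod>j<k i. card (primitive_constituent G (W i j))) * card T" .

  have T: "card T \<le> d ^ card S"
  proof (rule card_scalar_automorphisms[OF assms(1-3) _ S(1), where W = "\<lambda>(i, j). W i j"])
    show "T \<subseteq> Aut_form F" using sub(2) assms(5) by blast
    \<comment> \<open>Vectors are decomposed in two stages, first along the \<open>V i\<close> and
      then along the \<open>W i j\<close> inside each \<open>V i\<close>.\<close>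
    show "\<exists>u. (\<forall>a\<in>S. u a \<in> (case a of (i, j) \<Rightarrow> W i j)) \<and> v = (\<Sum>a\<in>S. u a)" for v
    proof -
      obtain x where x: "\<forall>i\<in>{..<m}. x i \<in> V i" "v = (\<Sum>i<m. x i)"
        using is_direct_sum_decompose[OF V(1), of v] by auto
      have "\<forall>i\<in>{..<m}. \<exists>y. (\<forall>j\<in>{..<k i}. y j \<in> W i j) \<and> x i = (\<Sum>j<k i. y j)"
        using is_direct_sum_decompose[OF W(1)] x(1) by auto
      then obtain y where y: "\<forall>i\<in>{..<m}. (\<forall>j\<in>{..<k i}. y i j \<in> W i j) \<and> x i = (\<Sum>j<k i. y i j)"
        by metis
      have "v = (\<Sum>a\<in>S. case a of (i, j) \<Rightarrow> y i j)"
        using x(2) y by (simp add: S_def sum.Sigma)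
      then show ?thesis using y by (intro exI[of _ "\<lambda>(i, j). y i j"]) (auto simp: S_def)
    qed
  qed (use Wsub in \<open>auto simp: S_def T_def\<close>)
  have "card G \<le> (\<Prod>i<m. fact (k i)) *
      ((\<Prod>i<m. \<Prod>j<k i. card (primitive_constituent G (W i j))) * d ^ card S)"
    using G K T by (meson le_trans mult_le_mono2)
  then show ?thesis using fin by (simp add: canonical_bound_def S(2) mult_ac)
qed

end
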